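(* Let $F$ be a fixed graph with $p\ge 3$ vertices and chromatic number $q\ge 2$. Then, as $n\to\infty$, $$\mathrm{Ts}(n,F)\le \mathrm{ex}(n,K_{(p-1)(q-1)+1})+o(n^2).$$ Moreover, for the complete graph $K_p$ (i.e. $q=p$) we have, for every $n$, $$\mathrm{Ts}(n,K_p)\le \mathrm{ex}(n,K_{(p-1)^2+1}).$$ Both upper bounds are asymptotically sharp as $n\to\infty$; that is, $\mathrm{Ts}(n,F)=(1+o(1))\,\mathrm{ex}(n,K_{(p-1)(q-1)+1})$ for every such fixed $F$ (in particular for $F=K_p$).
   Context: All graphs are finite and simple. A (not necessarily induced) subgraph $H$ of a host graph $G$ is singular if the degrees $d_G(v)$, $v\in V(H)$, taken in $G$, are all equal or pairwise distinct (isolated vertices of $H$ count as vertices). The singular Turán number $\mathrm{Ts}(n,F)$ is the maximum number of edges in a graph on $n$ vertices that contains no singular subgraph isomorphic to $F$. $\mathrm{ex}(n,K_s)$ is the classical Turán number: the maximum number of edges in a graph of order $n$ containing no complete subgraph $K_s$. *)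

theory Defs
  imports Complex_Main "HOL-Library.Landau_Symbols"
begin

type_synonym 'a sgraph = "'a set \<times> 'a set set"

abbreviation vertices :: "'a sgraph \<Rightarrow> 'a set" where
  "vertices G \<equiv> fst G"

abbreviation edges :: "'a sgraph \<Rightarrow> 'a set set" where
  "edges G \<equiv> snd G"

definition simple_graph :: "'a sgraph \<Rightarrow> bool" where
  "simple_graph G \<longleftrightarrow> finite (vertices G) \<and> (\<forall>e\<in>edges G. e \<subseteq> vertices G \<and> card e = 2)"

definition vertex_degree :: "'a sgraph \<Rightarrow> 'a \<Rightarrow> nat" where
  "vertex_degree G v = card {e \<in> edges G. v \<in> e}"

definition is_subgraph :: "'a sgraph \<Rightarrow> 'a sgraph \<Rightarrow> bool" where
  "is_subgraph H G \<longleftrightarrow>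
     simple_graph H \<and> vertices H \<subseteq> vertices G \<and> edges H \<subseteq> edges G"

definition isomorphic_graphs :: "'a sgraph \<Rightarrow> 'b sgraph \<Rightarrow> bool" where
  "isomorphic_graphs G H \<longleftrightarrow>
     (\<exists>f. bij_betw f (vertices G) (vertices H) \<and> (`) f ` edges G = edges H)"

text \<open>The degrees are those of the host graph \<open>G\<close>, not of \<open>H\<close>.\<close>

definition singular_in :: "'a sgraph \<Rightarrow> 'a sgraph \<Rightarrow> bool" where
  "singular_in G H \<longleftrightarrow>
     (\<forall>u\<in>vertices H. \<forall>v\<in>vertices H. vertex_degree G u = vertex_degree G v) \<or>
     (\<forall>u\<in>vertices H. \<forall>v\<in>vertices H. u \<noteq> v \<longrightarrow> vertex_degree G u \<noteq> vertex_degree G v)"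

definition complete_graph :: "nat \<Rightarrow> nat sgraph" where
  "complete_graph k = ({..<k}, {e. e \<subseteq> {..<k} \<and> card e = 2})"

definition proper_colouring :: "'a sgraph \<Rightarrow> ('a \<Rightarrow> nat) \<Rightarrow> nat \<Rightarrow> bool" where
  "proper_colouring G c k \<longleftrightarrow>
     c ` vertices G \<subseteq> {..<k} \<and>
     (\<forall>u\<in>vertices G. \<forall>v\<in>vertices G. {u, v} \<in> edges G \<longrightarrow> c u \<noteq> c v)"

definition chromatic_number :: "'a sgraph \<Rightarrow> nat" where
  "chromatic_number G = (LEAST k. \<exists>c. proper_colouring G c k)"

text \<open>
  Host graphs have natural numbers as vertices; up to isomorphism these are all finite graphs.
  The sets of edge numbers below are finite, and they contain \<open>0\<close> as soon as \<open>F\<close> has an edge;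
  if \<open>F\<close> has no edge they are empty for large \<open>n\<close>, and the value of \<open>Max\<close> is then meaningless.
\<close>

definition turan_number :: "nat \<Rightarrow> 'a sgraph \<Rightarrow> nat" where
  "turan_number n F =
     Max {card (edges G) | G :: nat sgraph.
            simple_graph G \<and> card (vertices G) = n \<and>
            \<not> (\<exists>H. is_subgraph H G \<and> isomorphic_graphs F H)}"

definition singular_turan_number :: "nat \<Rightarrow> 'a sgraph \<Rightarrow> nat" where
  "singular_turan_number n F =
     Max {card (edges G) | G :: nat sgraph.
            simple_graph G \<and> card (vertices G) = n \<and>
            \<not> (\<exists>H. is_subgraph H G \<and> singular_in G H \<and> isomorphic_graphs F H)}"

end

theory Submission
  imports Defs "HOL-Library.FuncSet" "HOL-Library.Discrete_Functions" "HOL-Real_Asymp.Real_Asymp"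
begin

text \<open>
  Put \<open>s = (p - 1) * (q - 1)\<close>. Both \<open>Ts(n, F)\<close> and \<open>ex(n, K\<^bsub>s+1\<^esub>)\<close>, divided by \<open>n\<^sup>2\<close>, tend to
  \<open>(1 - 1/s) / 2\<close> (lemmas \<open>singular_turan_density\<close> and \<open>turan_density\<close>). This limit is positive, so the
  difference of the two numbers is \<open>o(n\<^sup>2)\<close> and their ratio tends to 1.

  Upper bounds. A graph with \<open>((1 - 1/s)/2 + \<epsilon>) n\<^sup>2\<close> edges contains, by the Erdos--Stone theorem
  (\<open>blowup_of_many_edges\<close>), a complete \<open>(s+1)\<close>-partite graph with parts of any prescribed size. Parts of
  size \<open>p\<^sup>2\<close> suffice (\<open>singular_copy_of_blowup\<close>): each part shows either at least \<open>p\<close> different degrees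
  (it is diverse) or at least \<open>p\<close> vertices of one degree (it is uniform). If \<open>q\<close> parts are diverse, a copy
  of \<open>F\<close> with distinct degrees is chosen greedily in them; if \<open>q\<close> uniform parts share their degree, they
  contain a copy with equal degrees. Otherwise the uniform parts have so many different
  degrees that, together with one diverse part if there is any, they contain \<open>p\<close> vertices in different
  parts with distinct degrees, hence a copy of \<open>K\<^sub>p\<close>.

  Lower bounds. Take a nearly balanced complete \<open>s\<close>-partite graph, arrange the parts in \<open>p - 1\<close> groups of
  \<open>q - 1\<close> parts and let the degree of a vertex determine its group and conversely. Equal degrees
  then confine a copy of \<open>F\<close> to one group, which is \<open>(q - 1)\<close>-colourable, and distinct degrees allow it
  only \<open>p - 1\<close> vertices (\<open>singular_turan_number_ge_blueprint\<close>). With all parts of a group equally large, the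
  number of vertices is a multiple of \<open>q - 1\<close>. The other values of \<open>n\<close> need a correction. For \<open>p = 3\<close>
  a few isolated vertices can be added: the correction is needed only for \<open>q = 3\<close>, where \<open>F\<close> is a
  triangle. For \<open>p \<ge> 4\<close> the graph \<open>F\<close> may have isolated vertices itself; here one part of group 0 and one
  part of group 1 are made smaller than the other parts of their groups, and the degrees are
  equalised by deleting disjoint complete bipartite graphs between these two parts. Their sides
  have \<open>A\<close> and \<open>A'\<close> vertices, and \<open>A + A'\<close> can be given any residue modulo \<open>q - 1\<close>.

  The bound for \<open>K\<^sub>p\<close> at every \<open>n\<close> is a pigeonhole argument: among \<open>(p - 1)\<^sup>2 + 1\<close> vertices some \<open>p\<close> have
  equal degrees or some \<open>p\<close> have distinct degrees (\<open>singular_clique_of_clique\<close>).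
\<close>

section \<open>Finite graphs\<close>

lemma simple_graph_edgeD:
  assumes "simple_graph G" "{u, v} \<in> edges G"
  shows "u \<in> vertices G" "v \<in> vertices G" "u \<noteq> v"
proof -
  have "{u, v} \<subseteq> vertices G" "card {u, v} = 2"
    using assms unfolding simple_graph_def by blast+
  then show "u \<in> vertices G" "v \<in> vertices G" "u \<noteq> v" by auto
qed

lemma finite_edges:
  assumes "simple_graph G" shows "finite (edges G)"
proof -
  have "edges G \<subseteq> Pow (vertices G)" "finite (vertices G)"
    using assms unfolding simple_graph_def by auto
  then show ?thesis by (meson finite_Pow_iff finite_subset)
qed

lemma edge_doubleton:
  assumes "simple_graph G" "e \<in> edges G" "v \<in> e"
  obtains u where "e = {v, u}"
proof -
  have "card e = 2" using assms unfolding simple_graph_def by auto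
  then show ?thesis using assms(3) that by (auto simp: card_2_iff doubleton_eq_iff)
qed

lemma vertex_degree_eq_card_neighbours:
  assumes G: "simple_graph G"
  shows "vertex_degree G v = card {u \<in> vertices G. {v, u} \<in> edges G}"
proof -
  have "bij_betw (\<lambda>u. {v, u}) {u \<in> vertices G. {v, u} \<in> edges G} {e \<in> edges G. v \<in> e}"
    unfolding bij_betw_def
  proof (intro conjI equalityI subsetI)
    show "inj_on (\<lambda>u. {v, u}) {u \<in> vertices G. {v, u} \<in> edges G}"
      by (auto simp: inj_on_def doubleton_eq_iff)
  next
    fix e assume e: "e \<in> {e \<in> edges G. v \<in> e}"
    then obtain u where "e = {v, u}" using edge_doubleton[OF G] by blast
    then show "e \<in> (\<lambda>u. {v, u}) ` {u \<in> vertices G. {v, u} \<in> edges G}"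
      using e simple_graph_edgeD[OF G] by auto
  qed auto
  then show ?thesis unfolding vertex_degree_def by (simp add: bij_betw_same_card)
qed

lemma handshake:
  assumes G: "simple_graph G"
  shows "(\<Sum>v\<in>vertices G. vertex_degree G v) = 2 * card (edges G)"
  unfolding vertex_degree_def
proof (rule sum_multicount)
  show "finite (vertices G)" "finite (edges G)"
    using G finite_edges[OF G] by (auto simp: simple_graph_def)
  show "\<forall>e\<in>edges G. card {v \<in> vertices G. v \<in> e} = 2"
  proof
    fix e assume "e \<in> edges G"
    then have "e \<subseteq> vertices G" "card e = 2" using G by (auto simp: simple_graph_def)
    moreover from this have "{v \<in> vertices G. v \<in> e} = e" by auto
    ultimately show "card {v \<in> vertices G. v \<in> e} = 2" by simp
  qed
qed

lemma twice_card_edges_le: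
  assumes G: "simple_graph G"
  shows "2 * card (edges G) \<le> card (vertices G) * card (vertices G)"
proof -
  have fin: "finite (vertices G)" using G by (simp add: simple_graph_def)
  have "(\<Sum>v\<in>vertices G. vertex_degree G v) \<le> (\<Sum>v\<in>vertices G. card (vertices G))"
    unfolding vertex_degree_eq_card_neighbours[OF G]
    by (intro sum_mono card_mono fin) auto
  then show ?thesis using handshake[OF G] by simp
qed

definition graph_on :: "'a set \<Rightarrow> ('a \<Rightarrow> 'a \<Rightarrow> bool) \<Rightarrow> 'a sgraph" where
  "graph_on V adj = (V, {{u, v} | u v. u \<in> V \<and> v \<in> V \<and> adj u v})"

lemma vertices_graph_on [simp]: "vertices (graph_on V adj) = V"
  by (simp add: graph_on_def)

lemma edge_graph_on_iff:
  assumes "\<And>u v. adj u v \<Longrightarrow> adj v u"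
  shows "{u, v} \<in> edges (graph_on V adj) \<longleftrightarrow> u \<in> V \<and> v \<in> V \<and> adj u v"
  using assms by (auto simp: graph_on_def doubleton_eq_iff)

lemma simple_graph_on:
  assumes "finite V" "\<And>v. \<not> adj v v"
  shows "simple_graph (graph_on V adj)"
proof -
  have "card {u, v} = 2" if "adj u v" for u v
    using that assms(2) by (metis card_2_iff)
  then show ?thesis
    unfolding simple_graph_def graph_on_def using assms(1) by auto
qed

text \<open>
  A copy of \<open>F\<close> in \<open>G\<close> is handled through the injection of \<open>vertices F\<close> that it comes from: the
  next two lemmas translate between the two.
\<close>

lemma subgraph_copyI:
  assumes F: "simple_graph F"
    and inj: "inj_on f (vertices F)" and sub: "f ` vertices F \<subseteq> vertices G"
    and edge: "\<And>u v. {u, v} \<in> edges F \<Longrightarrow> {f u, f v} \<in> edges G"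
  shows "is_subgraph (f ` vertices F, (`) f ` edges F) G"
    and "isomorphic_graphs F (f ` vertices F, (`) f ` edges F)"
proof -
  have in_G: "f ` e \<in> edges G" "card (f ` e) = 2" "f ` e \<subseteq> f ` vertices F" if "e \<in> edges F" for e
  proof -
    have e: "e \<subseteq> vertices F" "card e = 2" using F that by (auto simp: simple_graph_def)
    then obtain u v where "e = {u, v}" by (auto simp: card_2_iff)
    then show "f ` e \<in> edges G" using edge that by simp
    show "card (f ` e) = 2" using e inj by (metis card_image inj_on_subset)
    show "f ` e \<subseteq> f ` vertices F" using e by auto
  qed
  have "finite (vertices F)" using F by (simp add: simple_graph_def)
  then show "is_subgraph (f ` vertices F, (`) f ` edges F) G"
    using in_G sub by (auto simp: is_subgraph_def simple_graph_def)
  show "isomorphic_graphs F (f ` vertices F, (`) f ` edges F)"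
    using inj unfolding isomorphic_graphs_def by (intro exI[of _ f]) (auto simp: bij_betw_def)
qed

lemma subgraph_copyE:
  assumes "is_subgraph H G" "isomorphic_graphs F H"
  obtains f where "inj_on f (vertices F)" "f ` vertices F = vertices H"
    "vertices H \<subseteq> vertices G" "\<And>u v. {u, v} \<in> edges F \<Longrightarrow> {f u, f v} \<in> edges G"
proof -
  obtain f where f: "bij_betw f (vertices F) (vertices H)" "(`) f ` edges F = edges H"
    using assms(2) unfolding isomorphic_graphs_def by blast
  have "{f u, f v} \<in> edges G" if "{u, v} \<in> edges F" for u v
  proof -
    have "f ` {u, v} \<in> edges H" using that f(2) by blast
    then show ?thesis using assms(1) by (auto simp: is_subgraph_def)
  qed
  then show ?thesis using that f(1) assms(1) by (auto simp: bij_betw_def is_subgraph_def)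
qed

text \<open>
  A graph that is not complete needs fewer colours than it has vertices, because two non-adjacent
  vertices may share a colour. So the only graph with 3 vertices and chromatic number 3 is the triangle.
\<close>

lemma chromatic_number_bounds:
  assumes "simple_graph F" "1 \<le> card (vertices F)"
  shows "\<exists>c. proper_colouring F c (chromatic_number F)"
    and "chromatic_number F \<le> card (vertices F)"
    and "chromatic_number F = card (vertices F) \<Longrightarrow> u \<in> vertices F \<Longrightarrow> v \<in> vertices F \<Longrightarrow> u \<noteq> v
      \<Longrightarrow> {u, v} \<in> edges F"
proof -
  define p where "p = card (vertices F)"
  have fin: "finite (vertices F)" using assms(1) by (simp add: simple_graph_def)
  obtain c where c: "bij_betw c (vertices F) {..<p}"
    using ex_bij_betw_finite_nat[OF fin] unfolding p_def atLeast0LessThan by blast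
  have cp: "proper_colouring F c p"
    unfolding proper_colouring_def
  proof (intro conjI ballI impI)
    fix u v assume uv: "u \<in> vertices F" "v \<in> vertices F" "{u, v} \<in> edges F"
    show "c u \<noteq> c v"
      using inj_onD[OF bij_betw_imp_inj_on[OF c] _ uv(1,2)] simple_graph_edgeD(3)[OF assms(1) uv(3)] by blast
  qed (use c in \<open>auto simp: bij_betw_def\<close>)
  then have ex: "\<exists>c. proper_colouring F c p" by (rule exI[of _ c])
  show "\<exists>c. proper_colouring F c (chromatic_number F)"
    unfolding chromatic_number_def by (rule LeastI[of "\<lambda>k. \<exists>c. proper_colouring F c k", OF ex])
  show "chromatic_number F \<le> card (vertices F)"
    unfolding chromatic_number_def p_def[symmetric] by (rule Least_le) (rule ex)
  show "{u, v} \<in> edges F"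
    if chi: "chromatic_number F = card (vertices F)" and uv: "u \<in> vertices F" "v \<in> vertices F" "u \<noteq> v"
  proof (rule ccontr)
    assume non: "{u, v} \<notin> edges F"
    have "card (vertices F - {v}) = p - 1" using uv fin by (simp add: p_def)
    then obtain c where c: "bij_betw c (vertices F - {v}) {..<p - 1}"
      using ex_bij_betw_finite_nat[of "vertices F - {v}"] fin unfolding atLeast0LessThan by auto
    define c' where "c' = c(v := c u)"
    have cu: "c w \<in> {..<p - 1}" if "w \<in> vertices F" "w \<noteq> v" for w
      using c that by (auto simp: bij_betw_def)
    have inj: "w = w'" if "w \<in> vertices F" "w \<noteq> v" "w' \<in> vertices F" "w' \<noteq> v" "c w = c w'" for w w'
      using c that by (auto simp: bij_betw_def inj_on_def)
    have "proper_colouring F c' (p - 1)"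
      unfolding proper_colouring_def
    proof (intro conjI ballI impI)
      show "c' ` vertices F \<subseteq> {..<p - 1}" using cu uv by (auto simp: c'_def)
    next
      fix a b assume ab: "a \<in> vertices F" "b \<in> vertices F" "{a, b} \<in> edges F"
      have "a \<noteq> b" using simple_graph_edgeD(3)[OF assms(1) ab(3)] .
      show "c' a \<noteq> c' b"
      proof
        assume eq: "c' a = c' b"
        consider "a = v" "b \<noteq> v" | "b = v" "a \<noteq> v" | "a \<noteq> v" "b \<noteq> v" using \<open>a \<noteq> b\<close> by blast
        then show False
        proof cases
          case 1
          then have "b = u" using inj[of b u] eq ab uv by (simp add: c'_def)
          then show False using 1 ab non by (simp add: insert_commute)
        next
          case 2
          then have "a = u" using inj[of a u] eq ab uv by (simp add: c'_def)
          then show False using 2 ab non by simp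
        next
          case 3
          then show False using inj[of a b] eq ab \<open>a \<noteq> b\<close> by (simp add: c'_def)
        qed
      qed
    qed
    then have "chromatic_number F \<le> p - 1"
      unfolding chromatic_number_def by (intro Least_le exI)
    then show False using chi assms(2) by (simp add: p_def)
  qed
qed

lemma simple_complete_graph: "simple_graph (complete_graph p)"
  by (auto simp: complete_graph_def simple_graph_def)

lemma complete_graph_edge_iff: "{i, j} \<in> edges (complete_graph p) \<longleftrightarrow> i < p \<and> j < p \<and> i \<noteq> j"
  by (auto simp: complete_graph_def card_2_iff doubleton_eq_iff)

lemma chromatic_number_complete_graph:
  assumes "1 \<le> p"
  shows "chromatic_number (complete_graph p) = p"
proof (rule antisym)
  have V: "vertices (complete_graph p) = {..<p}" by (simp add: complete_graph_def)
  show "chromatic_number (complete_graph p) \<le> p"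
    using chromatic_number_bounds(2)[OF simple_complete_graph, of p] assms by (simp add: V)
  obtain c where c: "proper_colouring (complete_graph p) c (chromatic_number (complete_graph p))"
    using chromatic_number_bounds(1)[OF simple_complete_graph, of p] assms by (auto simp: V)
  have "inj_on c {..<p}"
  proof (rule inj_onI, rule ccontr)
    fix i j assume ij: "i \<in> {..<p}" "j \<in> {..<p}" "c i = c j" "i \<noteq> j"
    then have "{i, j} \<in> edges (complete_graph p)" by (simp add: complete_graph_edge_iff)
    then show False using c ij by (auto simp: proper_colouring_def V)
  qed
  moreover have "c ` {..<p} \<subseteq> {..<chromatic_number (complete_graph p)}"
    using c by (auto simp: proper_colouring_def V)
  ultimately have "card {..<p} \<le> card {..<chromatic_number (complete_graph p)}"
    by (rule card_inj_on_le) simp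
  then show "p \<le> chromatic_number (complete_graph p)" by simp
qed

section \<open>Extremal numbers as maxima\<close>

lemma finite_edge_counts:
  "finite {card (edges G) | G :: nat sgraph. simple_graph G \<and> card (vertices G) = n \<and> Q G}"
proof (rule finite_subset)
  show "{card (edges G) | G :: nat sgraph. simple_graph G \<and> card (vertices G) = n \<and> Q G} \<subseteq> {..n * n}"
    using twice_card_edges_le by fastforce
qed simp

lemma edgeless_graph_free:
  assumes "edges F \<noteq> {}"
  shows "simple_graph ({..<n}, {} :: nat set set)"
    and "\<not> (\<exists>H. is_subgraph H ({..<n}, {} :: nat set set) \<and> isomorphic_graphs F H)"
  using assms by (auto simp: simple_graph_def is_subgraph_def isomorphic_graphs_def)

lemma card_edges_le_turan_number:
  fixes G :: "nat sgraph"
  assumes "simple_graph G" "card (vertices G) = n"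
    and "\<not> (\<exists>H. is_subgraph H G \<and> isomorphic_graphs F H)"
  shows "card (edges G) \<le> turan_number n F"
  unfolding turan_number_def using assms by (intro Max_ge finite_edge_counts CollectI exI[of _ G]) simp

lemma card_edges_le_singular_turan_number:
  fixes G :: "nat sgraph"
  assumes "simple_graph G" "card (vertices G) = n"
    and "\<not> (\<exists>H. is_subgraph H G \<and> singular_in G H \<and> isomorphic_graphs F H)"
  shows "card (edges G) \<le> singular_turan_number n F"
  unfolding singular_turan_number_def using assms by (intro Max_ge finite_edge_counts CollectI exI[of _ G]) simp

lemma Max_edge_count_attained:
  fixes Q :: "nat sgraph \<Rightarrow> bool"
  assumes "simple_graph G" "card (vertices G) = n" "Q G"
  shows "\<exists>G'. simple_graph G' \<and> card (vertices G') = n \<and> Q G' \<and>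
    card (edges G') = Max {card (edges G) | G. simple_graph G \<and> card (vertices G) = n \<and> Q G}"
proof -
  let ?S = "{card (edges G) | G. simple_graph G \<and> card (vertices G) = n \<and> Q G}"
  have "card (edges G) \<in> ?S" using assms by blast
  then have "?S \<noteq> {}" by (metis empty_iff)
  then have "Max ?S \<in> ?S" by (rule Max_in[OF finite_edge_counts])
  then show ?thesis by (smt (verit) mem_Collect_eq)
qed

lemma turan_number_attained:
  assumes "edges F \<noteq> {}"
  obtains G :: "nat sgraph" where "simple_graph G" "card (vertices G) = n"
    "\<not> (\<exists>H. is_subgraph H G \<and> isomorphic_graphs F H)" "card (edges G) = turan_number n F"
  unfolding turan_number_def
  using Max_edge_count_attained[of "({..<n}, {})" n
      "\<lambda>G. \<not> (\<exists>H. is_subgraph H G \<and> isomorphic_graphs F H)"]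
    edgeless_graph_free[OF assms]
  by auto

lemma singular_turan_number_attained:
  assumes "edges F \<noteq> {}"
  obtains G :: "nat sgraph" where "simple_graph G" "card (vertices G) = n"
    "\<not> (\<exists>H. is_subgraph H G \<and> singular_in G H \<and> isomorphic_graphs F H)"
    "card (edges G) = singular_turan_number n F"
proof -
  let ?Q = "\<lambda>G. \<not> (\<exists>H. is_subgraph H G \<and> singular_in G H \<and> isomorphic_graphs F H)"
  have "?Q ({..<n}, {})" using edgeless_graph_free(2)[OF assms] by blast
  then show ?thesis
    using Max_edge_count_attained[of "({..<n}, {})" n ?Q] edgeless_graph_free(1)[OF assms] that
    unfolding singular_turan_number_def by fastforce
qed

section \<open>The Erdos--Stone theorem\<close>

text \<open>
  For an irreflexive \<open>E\<close> the second clause makes the parts disjoint, so this says that \<open>E\<close> contains the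
  complete \<open>r\<close>-partite graph with parts of size \<open>t\<close>.
\<close>

definition has_blowup :: "('a \<Rightarrow> 'a \<Rightarrow> bool) \<Rightarrow> 'a set \<Rightarrow> nat \<Rightarrow> nat \<Rightarrow> (nat \<Rightarrow> 'a set) \<Rightarrow> bool" where
  "has_blowup E U r t X \<longleftrightarrow>
     (\<forall>i<r. X i \<subseteq> U \<and> card (X i) = t) \<and>
     (\<forall>i<r. \<forall>j<r. i \<noteq> j \<longrightarrow> (\<forall>u\<in>X i. \<forall>v\<in>X j. E u v))"

lemma has_blowupD:
  assumes "has_blowup E U r t X"
  shows "i < r \<Longrightarrow> X i \<subseteq> U" "i < r \<Longrightarrow> card (X i) = t"
    and "i < r \<Longrightarrow> j < r \<Longrightarrow> i \<noteq> j \<Longrightarrow> u \<in> X i \<Longrightarrow> v \<in> X j \<Longrightarrow> E u v"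
  using assms by (simp_all add: has_blowup_def)

lemma pigeonhole_fibre:
  assumes "finite A" "finite B" "f ` A \<subseteq> B" "k * card B < card A"
  shows "\<exists>y\<in>B. k < card {x \<in> A. f x = y}"
proof (rule ccontr)
  assume "\<not> ?thesis"
  then have le: "card {x \<in> A. f x = y} \<le> k" if "y \<in> B" for y using that by auto
  have "card A = (\<Sum>y\<in>B. card {x \<in> A. f x = y})"
    using sum.group[OF assms(1-3), of "\<lambda>_. 1::nat"] by simp
  also have "\<dots> \<le> card B * k" using sum_mono[of B, OF le] by simp
  finally show False using assms(4) by (simp add: mult.commute)
qed

text \<open>
  A vertex with \<open>t\<close> neighbours in each part selects \<open>t\<close> of them in each part. There are at most
  \<open>(2 ^ T) ^ k\<close> possible selections, so \<open>t\<close> of the vertices make the same one; these vertices form a new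
  part, and the selected sets are the old parts, cut down to size \<open>t\<close>.
\<close>

lemma blowup_extend:
  assumes fU: "finite U" and sym: "\<And>u v. E u v \<Longrightarrow> E v u"
    and X: "has_blowup E U k T X"
    and good: "good \<subseteq> {v \<in> U. \<forall>i<k. t \<le> card {u \<in> X i. E v u}}"
    and many: "t * (2 ^ T) ^ k < card good"
  shows "\<exists>Y. has_blowup E U (Suc k) t Y"
proof -
  have XU: "X i \<subseteq> U" and cX: "card (X i) = T" and fX: "finite (X i)" if "i < k" for i
    using has_blowupD(1,2)[OF X] that finite_subset[OF _ fU] by auto
  have "\<exists>S. S \<subseteq> X i \<and> card S = t \<and> (\<forall>u\<in>S. E v u)" if "v \<in> good" "i < k" for v i
  proof -
    have "t \<le> card {u \<in> X i. E v u}" using good that by auto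
    then obtain S where "S \<subseteq> {u \<in> X i. E v u}" "card S = t" by (meson obtain_subset_with_card_n)
    then show ?thesis by auto
  qed
  then obtain S where S: "\<And>v i. v \<in> good \<Longrightarrow> i < k \<Longrightarrow>
      S v i \<subseteq> X i \<and> card (S v i) = t \<and> (\<forall>u\<in>S v i. E v u)" by metis
  define f where "f v = restrict (S v) {..<k}" for v
  define B where "B = PiE {..<k} (\<lambda>i. Pow (X i))"
  have "card B = (2 ^ T) ^ k"
    unfolding B_def by (subst card_PiE) (auto simp: card_Pow fX cX)
  moreover have "finite B" unfolding B_def by (intro finite_PiE) (auto simp: fX)
  moreover have "f ` good \<subseteq> B" using S unfolding f_def B_def by (force simp: PiE_iff)
  moreover have "finite good" by (rule finite_subset[OF good]) (simp add: fU)
  ultimately obtain y where "t < card {v \<in> good. f v = y}"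
    using pigeonhole_fibre[of good B f t] many by auto
  then obtain Z where Z: "Z \<subseteq> {v \<in> good. f v = y}" "card Z = t"
    by (meson obtain_subset_with_card_n less_imp_le)
  have yS: "y i = S v i" if "v \<in> Z" "i < k" for v i
  proof -
    have "y = f v" using Z that by auto
    then show ?thesis using that by (simp add: f_def)
  qed
  define Y where "Y i = (if i < k then (if Z = {} then {} else y i) else Z)" for i
  have "has_blowup E U (Suc k) t Y"
  proof (cases "Z = {}")
    case True
    then show ?thesis using Z by (auto simp: has_blowup_def Y_def)
  next
    case False
    then obtain z where z: "z \<in> Z" by auto
    have gz: "v \<in> good" if "v \<in> Z" for v using Z that by auto
    have yi: "y i \<subseteq> X i" "card (y i) = t" if "i < k" for i
      using S[OF gz[OF z] that] yS[OF z that] by auto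
    have yE: "E v u" if "v \<in> Z" "i < k" "u \<in> y i" for v u i
      using S[OF gz[OF that(1)] that(2)] yS[OF that(1,2)] that(3) by auto
    have XE: "E u v" if "i < k" "j < k" "i \<noteq> j" "u \<in> y i" "v \<in> y j" for i j u v
      using has_blowupD(3)[OF X that(1-3)] yi that by blast
    have yU: "y i \<subseteq> U" if "i < k" for i using yi(1)[OF that] XU[OF that] by simp
    have ZU: "Z \<subseteq> U" using Z good by blast
    show ?thesis
      unfolding has_blowup_def
    proof (intro conjI allI impI ballI)
      fix i assume "i < Suc k"
      then show "Y i \<subseteq> U" "card (Y i) = t"
        using False Z(2) ZU yi(2) yU unfolding Y_def by (auto simp: less_Suc_eq split: if_splits)
    next
      fix i j u v assume "i < Suc k" "j < Suc k" "i \<noteq> j" "u \<in> Y i" "v \<in> Y j"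
      then show "E u v"
        using False XE yE sym unfolding Y_def by (auto split: if_splits simp: less_Suc_eq)
    qed
  qed
  then show ?thesis by (rule exI[of _ Y])
qed

text \<open>
  Count the edges between the blow-up and the remaining vertices. The minimum degree bounds their
  number from below; a vertex without \<open>t\<close> neighbours in some part contributes at most \<open>k * T + t\<close>, and
  any other at most \<open>(k + 1) * T\<close>. The first kind alone cannot reach the lower bound.
\<close>

lemma many_rich_vertices:
  assumes fU: "finite U" and sym: "\<And>u v. E u v \<Longrightarrow> E v u"
    and X: "has_blowup E U (Suc k) T X"
    and deg: "\<And>v. v \<in> U \<Longrightarrow> (1 - 1 / real (Suc k) + \<epsilon>) * real (card U) \<le> real (card {u \<in> U. E v u})"
    and eps: "real t + 1 \<le> real (Suc k) * real T * \<epsilon>"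
  shows "real (card U) - (real (Suc k) * real T)\<^sup>2
      \<le> real (Suc k) * real T * real (card {v \<in> U. \<forall>i<Suc k. t \<le> card {u \<in> X i. E v u}})"
proof -
  define K where "K = Suc k"
  define n where "n = real (card U)"
  define W where "W = (\<Union>i<K. X i)"
  define good where "good = {v \<in> U. \<forall>i<K. t \<le> card {u \<in> X i. E v u}}"
  have XU: "X i \<subseteq> U" and cX: "card (X i) = T" and fX: "finite (X i)" if "i < K" for i
    using has_blowupD(1,2)[OF X] that finite_subset[OF _ fU] by (auto simp: K_def)
  have WU: "W \<subseteq> U" using XU unfolding W_def by auto
  have "card W \<le> (\<Sum>i<K. card (X i))" unfolding W_def by (rule card_UN_le) simp
  then have cW: "card W \<le> K * T" by (simp add: cX)
  have fgood: "finite good" "good \<subseteq> U" unfolding good_def using fU by auto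
  have out: "(1 - 1 / real K + \<epsilon>) * n - real K * real T \<le> real (card {v \<in> U - W. E u v})"
    if "u \<in> U" for u
  proof -
    have "{v \<in> U. E u v} \<subseteq> {v \<in> U - W. E u v} \<union> W" by auto
    then have "card {v \<in> U. E u v} \<le> card ({v \<in> U - W. E u v} \<union> W)"
      using fU WU by (intro card_mono) (auto intro: finite_subset)
    also have "\<dots> \<le> card {v \<in> U - W. E u v} + K * T"
      using card_Un_le[of "{v \<in> U - W. E u v}" W] cW by linarith
    finally have "real (card {v \<in> U. E u v}) \<le> real (card {v \<in> U - W. E u v}) + real K * real T"
      by (metis of_nat_add of_nat_le_iff of_nat_mult)
    then show ?thesis using deg[OF that] unfolding K_def n_def by linarith
  qed
  have "real K * (real T * ((1 - 1 / real K + \<epsilon>) * n - real K * real T))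
      = (\<Sum>i<K. \<Sum>u\<in>X i. (1 - 1 / real K + \<epsilon>) * n - real K * real T)"
    by (simp add: cX)
  also have "\<dots> \<le> (\<Sum>i<K. \<Sum>u\<in>X i. real (card {v \<in> U - W. E u v}))"
    using XU by (intro sum_mono out) auto
  also have "\<dots> = real (\<Sum>i<K. \<Sum>u\<in>X i. \<Sum>v\<in>U-W. if E u v then 1 else 0)"
    using fU by (simp add: sum.If_cases Int_def)
  also have "(\<Sum>i<K. \<Sum>u\<in>X i. \<Sum>v\<in>U-W. if E u v then 1 else 0)
      = (\<Sum>v\<in>U-W. \<Sum>i<K. \<Sum>u\<in>X i. if E u v then 1 else (0::nat))"
    using sum.swap[of "\<lambda>i v. \<Sum>u\<in>X i. if E u v then 1 else (0::nat)" "U - W" "{..<K}"]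
    by (simp add: sum.swap[of _ "U - W" "X _"])
  also have "\<dots> = (\<Sum>v\<in>U-W. \<Sum>i<K. card {u \<in> X i. E v u})"
  proof -
    have "E u v = E v u" for u v using sym by blast
    then show ?thesis using fX by (intro sum.cong refl) (simp add: sum.If_cases Int_def)
  qed
  also have "\<dots> \<le> (\<Sum>v\<in>U-W. k * T + t + (if v \<in> good then K * T else 0))"
  proof (rule sum_mono)
    fix v assume v: "v \<in> U - W"
    have le: "card {u \<in> X i. E v u} \<le> T" if "i < K" for i
      using card_mono[OF fX[OF that], of "{u \<in> X i. E v u}"] cX[OF that] by auto
    show "(\<Sum>i<K. card {u \<in> X i. E v u}) \<le> k * T + t + (if v \<in> good then K * T else 0)"
    proof (cases "v \<in> good")
      case True
      have "(\<Sum>i<K. card {u \<in> X i. E v u}) \<le> (\<Sum>i<K. T)" using le by (intro sum_mono) auto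
      then show ?thesis using True by simp
    next
      case False
      then obtain j where j: "j < K" "card {u \<in> X j. E v u} < t"
        using v by (auto simp: good_def not_le)
      have "(\<Sum>i<K. card {u \<in> X i. E v u})
          = card {u \<in> X j. E v u} + (\<Sum>i\<in>{..<K}-{j}. card {u \<in> X i. E v u})"
        using j by (simp add: sum.remove)
      also have "(\<Sum>i\<in>{..<K}-{j}. card {u \<in> X i. E v u}) \<le> (\<Sum>i\<in>{..<K}-{j}. T)"
        using le by (intro sum_mono) auto
      also have "\<dots> = k * T" using j by (simp add: K_def)
      finally show ?thesis using j False by simp
    qed
  qed
  also have "\<dots> \<le> card U * (k * T + t) + card good * (K * T)"
  proof -
    have "card (U - W) * (k * T + t) \<le> card U * (k * T + t)"
      using fU by (intro mult_right_mono card_mono) auto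
    moreover have "(\<Sum>v\<in>U-W. if v \<in> good then K * T else 0) \<le> (\<Sum>v\<in>U. if v \<in> good then K * T else 0)"
      using fU by (intro sum_mono2) auto
    moreover have "(\<Sum>v\<in>U. if v \<in> good then K * T else 0) = card good * (K * T)"
      using fgood fU by (simp add: sum.If_cases Int_absorb1)
    moreover have "(\<Sum>v\<in>U-W. k * T + t + (if v \<in> good then K * T else 0))
        = card (U - W) * (k * T + t) + (\<Sum>v\<in>U-W. if v \<in> good then K * T else 0)"
      by (simp only: sum.distrib sum_constant of_nat_id distrib_left)
    ultimately show ?thesis by linarith
  qed
  finally have "real K * (real T * ((1 - 1 / real K + \<epsilon>) * n - real K * real T))
      \<le> n * (real k * real T + real t) + real (card good) * (real K * real T)"
    unfolding n_def by (simp add: algebra_simps flip: of_nat_mult of_nat_add)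
  moreover have "real K * (real T * ((1 - 1 / real K + \<epsilon>) * n - real K * real T))
      = n * (real k * real T) + n * (real K * real T * \<epsilon>) - (real K * real T)\<^sup>2"
    unfolding K_def by (simp add: field_simps power2_eq_square)
  moreover have "n * (real t + 1) \<le> n * (real K * real T * \<epsilon>)"
    using eps unfolding K_def n_def by (intro mult_left_mono) auto
  ultimately have "n - (real K * real T)\<^sup>2 \<le> real K * real T * real (card good)"
    by (simp add: algebra_simps)
  then show ?thesis unfolding n_def good_def K_def .
qed

text \<open>
  By induction on the number of parts: a blow-up with very large parts is extended by a further
  part at the cost of shrinking the old ones.
\<close>

lemma blowup_of_min_degree:
  assumes "0 < \<epsilon>"
  shows "\<exists>n0. \<forall>(U :: 'a set) E. finite U \<longrightarrow> n0 \<le> card U \<longrightarrow> (\<forall>u v. E u v \<longrightarrow> E v u) \<longrightarrow>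
      (\<forall>v\<in>U. (1 - 1 / real k + \<epsilon>) * real (card U) \<le> real (card {u \<in> U. E v u})) \<longrightarrow>
      (\<exists>X. has_blowup E U (Suc k) t X)"
proof (induction k arbitrary: t)
  case 0
  have "\<exists>X. has_blowup E U (Suc 0) t X" if t: "t \<le> card U" for U :: "'a set" and E
  proof -
    obtain S where "S \<subseteq> U" "card S = t" using t by (meson obtain_subset_with_card_n)
    then show ?thesis by (intro exI[of _ "\<lambda>_. S"]) (auto simp: has_blowup_def)
  qed
  then show ?case by blast
next
  case (Suc k)
  \<comment> \<open>Parts of this size leave a surplus of at least one edge per vertex in the double count.\<close>
  define T where "T = nat \<lceil>(real t + 1) / \<epsilon>\<rceil> + 1"
  have "(real t + 1) / \<epsilon> \<le> real T" unfolding T_def by linarith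
  then have "real t + 1 \<le> real T * \<epsilon>" using assms by (simp add: field_simps)
  moreover have "1 * (real T * \<epsilon>) \<le> real (Suc k) * (real T * \<epsilon>)"
    using assms by (intro mult_right_mono) auto
  ultimately have eps: "real t + 1 \<le> real (Suc k) * real T * \<epsilon>" by (simp add: mult.assoc)
  from Suc.IH[of T] obtain n1 where n1: "\<forall>(U :: 'a set) E. finite U \<longrightarrow> n1 \<le> card U \<longrightarrow>
      (\<forall>u v. E u v \<longrightarrow> E v u) \<longrightarrow>
      (\<forall>v\<in>U. (1 - 1 / real k + \<epsilon>) * real (card U) \<le> real (card {u \<in> U. E v u})) \<longrightarrow>
      (\<exists>X. has_blowup E U (Suc k) T X)" by (rule exE)
  define C where "C = t * (2 ^ T) ^ Suc k"
  define n0 where "n0 = Suc (max (max n1 T) ((Suc k * T)\<^sup>2 + Suc k * T * C))"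
  have "\<exists>Y. has_blowup E U (Suc (Suc k)) t Y"
    if fU: "finite U" and big: "n0 \<le> card U" and sym: "\<forall>u v. E u v \<longrightarrow> E v u"
      and deg: "\<forall>v\<in>U. (1 - 1 / real (Suc k) + \<epsilon>) * real (card U) \<le> real (card {u \<in> U. E v u})"
    for U :: "'a set" and E
  proof -
    have "\<exists>X. has_blowup E U (Suc k) T X"
    proof (cases "k = 0")
      case True
      have "T \<le> card U" using big by (simp add: n0_def)
      then obtain S where "S \<subseteq> U" "card S = T" by (meson obtain_subset_with_card_n)
      then show ?thesis using True by (intro exI[of _ "\<lambda>_. S"]) (auto simp: has_blowup_def)
    next
      case False
      have "(1 - 1 / real k + \<epsilon>) * real (card U) \<le> (1 - 1 / real (Suc k) + \<epsilon>) * real (card U)"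
        using False by (intro mult_right_mono) (auto simp: field_simps)
      then have "\<forall>v\<in>U. (1 - 1 / real k + \<epsilon>) * real (card U) \<le> real (card {u \<in> U. E v u})"
        using deg by (meson order_trans)
      then show ?thesis using n1 fU sym big by (simp add: n0_def)
    qed
    then obtain X where X: "has_blowup E U (Suc k) T X" ..
    let ?good = "{v \<in> U. \<forall>i<Suc k. t \<le> card {u \<in> X i. E v u}}"
    have "real (card U) - (real (Suc k) * real T)\<^sup>2 \<le> real (Suc k) * real T * real (card ?good)"
      by (rule many_rich_vertices[OF fU _ X _ eps]) (use sym deg in blast)+
    moreover have "real ((Suc k * T)\<^sup>2 + Suc k * T * C) < real (card U)"
      using big unfolding n0_def of_nat_less_iff by linarith
    ultimately have "real (Suc k * T) * real C < real (Suc k * T) * real (card ?good)"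
      unfolding of_nat_add of_nat_mult of_nat_power by linarith
    then have "C < card ?good" by (simp add: mult_less_cancel_left del: of_nat_Suc of_nat_mult)
    then show ?thesis
      using sym by (intro blowup_extend[OF fU _ X order_refl]) (auto simp: C_def)
  qed
  then show ?case by (intro exI[of _ n0] allI impI)
qed

text \<open>
  Let \<open>U\<close> maximise the number of induced edges minus \<open>\<alpha>/2 * |U| * (|U| + 1)\<close>. Deleting a vertex lowers the
  subtracted term by exactly \<open>\<alpha> * |U|\<close>, so by maximality every vertex of \<open>U\<close> has at least that degree in \<open>U\<close>. The
  set of all vertices scores at least \<open>\<epsilon>/2 * n\<^sup>2\<close>, while \<open>U\<close> scores at most \<open>|U|\<^sup>2 / 2\<close>, so \<open>U\<close> is large.
\<close>

lemma induced_subgraph_of_large_min_degree: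
  fixes G :: "'a sgraph"
  assumes G: "simple_graph G" and eps: "0 < \<epsilon>" and a: "0 \<le> \<alpha>"
    and many: "(\<alpha> / 2 + \<epsilon>) * (real (card (vertices G)))\<^sup>2 \<le> real (card (edges G))"
    and big: "\<alpha> \<le> \<epsilon> * real (card (vertices G))"
  shows "\<exists>U. U \<subseteq> vertices G \<and> \<epsilon> / 2 * (real (card (vertices G)))\<^sup>2 \<le> (real (card U))\<^sup>2 \<and>
    (\<forall>v\<in>U. \<alpha> * real (card U) \<le> real (card {u \<in> U. {v, u} \<in> edges G}))"
proof -
  define V where "V = vertices G"
  define E where "E = edges G"
  define n where "n = real (card V)"
  have fV: "finite V" and fE: "finite E" and EV: "\<And>e. e \<in> E \<Longrightarrow> e \<subseteq> V \<and> card e = 2"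
    using G finite_edges[OF G] by (auto simp: simple_graph_def V_def E_def)
  define e where "e U = card {x \<in> E. x \<subseteq> U}" for U
  define f where "f U = real (e U) - \<alpha> / 2 * (real (card U) * (real (card U) + 1))" for U
  have fin: "finite (f ` Pow V)" and "f ` Pow V \<noteq> {}" using fV by auto
  then have "Max (f ` Pow V) \<in> f ` Pow V" by (rule Max_in)
  then obtain U where U: "U \<subseteq> V" "f U = Max (f ` Pow V)" by auto
  have opt: "f U' \<le> f U" if "U' \<subseteq> V" for U'
    using fin that U by (simp add: Max_ge)
  have fU: "finite U" using U fV finite_subset by blast
  have sg: "simple_graph (U, {x \<in> E. x \<subseteq> U})"
    using fU EV by (auto simp: simple_graph_def)
  have "2 * e U \<le> card U * card U" using twice_card_edges_le[OF sg] by (simp add: e_def)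
  then have "2 * real (e U) \<le> (real (card U))\<^sup>2"
    unfolding power2_eq_square by (metis of_nat_le_iff of_nat_mult of_nat_numeral)
  then have fU_le: "2 * f U \<le> (real (card U))\<^sup>2"
    using mult_nonneg_nonneg[OF a, of "real (card U) * (real (card U) + 1)"] unfolding f_def by simp
  have "{x \<in> E. x \<subseteq> V} = E" using EV by auto
  then have "f V = real (card E) - \<alpha> / 2 * (n * (n + 1))"
    by (simp add: f_def e_def n_def)
  moreover have "(\<alpha> / 2 + \<epsilon>) * n\<^sup>2 \<le> real (card E)" using many by (simp add: n_def V_def E_def)
  moreover have "\<alpha> * n \<le> \<epsilon> * n * n" using big by (intro mult_right_mono) (auto simp: n_def V_def)
  ultimately have "\<epsilon> / 2 * n\<^sup>2 \<le> f V" by (simp add: field_simps power2_eq_square)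
  moreover have "0 \<le> \<epsilon> / 2 * n\<^sup>2" using eps by simp
  ultimately have large: "\<epsilon> / 2 * n\<^sup>2 \<le> (real (card U))\<^sup>2" using fU_le opt[of V] by simp
  have "\<alpha> * real (card U) \<le> real (card {u \<in> U. {v, u} \<in> E})" if v: "v \<in> U" for v
  proof -
    let ?D = "{x \<in> {x \<in> E. x \<subseteq> U}. v \<in> x}"
    have split: "{x \<in> E. x \<subseteq> U} = {x \<in> E. x \<subseteq> U - {v}} \<union> ?D" by auto
    have "e U = card ({x \<in> E. x \<subseteq> U - {v}} \<union> ?D)"
      unfolding e_def by (rule arg_cong[of _ _ card, OF split])
    also have "\<dots> = e (U - {v}) + card ?D"
      unfolding e_def using fE by (intro card_Un_disjoint) auto
    finally have "e U = e (U - {v}) + card ?D" .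
    moreover have "card ?D = card {u \<in> U. {v, u} \<in> E}"
    proof -
      have "{u \<in> U. {v, u} \<in> {x \<in> E. x \<subseteq> U}} = {u \<in> U. {v, u} \<in> E}" using v by auto
      then show ?thesis
        using vertex_degree_eq_card_neighbours[OF sg, of v] by (simp add: vertex_degree_def)
    qed
    moreover have "f (U - {v}) \<le> f U" using U by (intro opt) auto
    moreover have "real (card (U - {v})) = real (card U) - 1"
      using card.remove[OF fU v] by simp
    ultimately show ?thesis unfolding f_def by (simp add: field_simps)
  qed
  then show ?thesis using U large unfolding n_def V_def E_def by blast
qed

text \<open>
  A graph with this many edges has a large induced subgraph to which the minimum degree version
  applies; half of \<open>\<epsilon>\<close> pays for the passage.
\<close>

lemma blowup_of_many_edges:
  assumes eps: "0 < \<epsilon>" and k: "1 \<le> k"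
  shows "\<exists>n0. \<forall>G :: 'a sgraph. simple_graph G \<and> n0 \<le> card (vertices G) \<and>
      ((1 - 1 / real k) / 2 + \<epsilon>) * (real (card (vertices G)))\<^sup>2 \<le> real (card (edges G)) \<longrightarrow>
      (\<exists>X. has_blowup (\<lambda>u v. {u, v} \<in> edges G) (vertices G) (Suc k) t X)"
proof -
  define \<alpha> where "\<alpha> = 1 - 1 / real k + \<epsilon>"
  have "1 / real k \<le> 1" using k by simp
  then have a: "0 \<le> \<alpha>" using eps unfolding \<alpha>_def by simp
  from blowup_of_min_degree[OF eps, of k t]
  obtain n1 where n1: "\<forall>(U :: 'a set) E. finite U \<longrightarrow> n1 \<le> card U \<longrightarrow>
      (\<forall>u v. E u v \<longrightarrow> E v u) \<longrightarrow>
      (\<forall>v\<in>U. \<alpha> * real (card U) \<le> real (card {u \<in> U. E v u})) \<longrightarrow>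
      (\<exists>X. has_blowup E U (Suc k) t X)" unfolding \<alpha>_def by (rule exE)
  define n0 where "n0 = nat \<lceil>2 * \<alpha> / \<epsilon>\<rceil> + nat \<lceil>4 * (real n1)\<^sup>2 / \<epsilon>\<rceil> + 1"
  have "\<exists>X. has_blowup (\<lambda>u v. {u, v} \<in> edges G) (vertices G) (Suc k) t X"
    if G: "simple_graph G" and n: "n0 \<le> card (vertices G)"
      and many: "((1 - 1 / real k) / 2 + \<epsilon>) * (real (card (vertices G)))\<^sup>2 \<le> real (card (edges G))"
    for G :: "'a sgraph"
  proof -
    define N where "N = real (card (vertices G))"
    have N: "2 * \<alpha> / \<epsilon> \<le> N" "4 * (real n1)\<^sup>2 / \<epsilon> \<le> N" "1 \<le> N"
      using n unfolding n0_def N_def by linarith+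
    have "\<alpha> \<le> \<epsilon> / 2 * N" using N(1) eps by (simp add: field_simps)
    moreover have many': "(\<alpha> / 2 + \<epsilon> / 2) * (real (card (vertices G)))\<^sup>2 \<le> real (card (edges G))"
    proof -
      have "\<alpha> / 2 + \<epsilon> / 2 = (1 - 1 / real k) / 2 + \<epsilon>"
        by (simp add: \<alpha>_def add_divide_distrib)
      then show ?thesis using many by (simp only:)
    qed
    ultimately obtain U where U: "U \<subseteq> vertices G" "\<epsilon> / 2 / 2 * N\<^sup>2 \<le> (real (card U))\<^sup>2"
      "\<forall>v\<in>U. \<alpha> * real (card U) \<le> real (card {u \<in> U. {v, u} \<in> edges G})"
      using induced_subgraph_of_large_min_degree[OF G _ a, of "\<epsilon> / 2"] many' eps
      unfolding N_def by auto
    have "(real n1)\<^sup>2 \<le> \<epsilon> / 4 * N" using N(2) eps by (simp add: field_simps)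
    also have "\<dots> \<le> \<epsilon> / 4 * N\<^sup>2"
      using N(3) eps by (intro mult_left_mono) (auto simp: power2_eq_square)
    also have "\<dots> \<le> (real (card U))\<^sup>2" using U(2) by simp
    finally have "n1 \<le> card U" by (metis of_nat_le_iff power2_le_imp_le of_nat_0_le_iff)
    moreover have "finite U" using U(1) G finite_subset by (auto simp: simple_graph_def)
    ultimately obtain X where "has_blowup (\<lambda>u v. {u, v} \<in> edges G) U (Suc k) t X"
      using n1[rule_format, of U "\<lambda>u v. {u, v} \<in> edges G"] U(3) by (auto simp: insert_commute)
    then have "has_blowup (\<lambda>u v. {u, v} \<in> edges G) (vertices G) (Suc k) t X"
      using U(1) by (auto simp: has_blowup_def)
    then show ?thesis by (rule exI[of _ X])
  qed
  then show ?thesis by (intro exI[of _ n0] allI impI) simp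
qed

section \<open>Singular copies in blow-ups and in cliques\<close>

text \<open>
  Greedy choice: fewer than \<open>card S\<close> values have been used at any time.
\<close>

lemma distinct_representatives:
  assumes "finite S" "\<And>v. v \<in> S \<Longrightarrow> finite (A v)" "\<And>v. v \<in> S \<Longrightarrow> card S \<le> card (A v)"
  shows "\<exists>g. inj_on g S \<and> (\<forall>v\<in>S. g v \<in> A v)"
  using assms
proof (induction S rule: finite_induct)
  case empty
  then show ?case by simp
next
  case (insert x S)
  have "card S \<le> card (A v)" if "v \<in> S" for v
    using insert.prems(2)[of v] insert.hyps that by simp
  then obtain g where g: "inj_on g S" "\<forall>v\<in>S. g v \<in> A v"
    using insert.IH insert.prems(1) by auto
  have "card (g ` S) < card (A x)"
    using card_image_le[OF insert.hyps(1), of g] insert.prems(2)[of x] insert.hyps by simp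
  then have "\<not> A x \<subseteq> g ` S"
    using card_mono[of "g ` S" "A x"] insert.hyps(1) by (meson finite_imageI not_le)
  then obtain y where "y \<in> A x" "y \<notin> g ` S" by auto
  then show ?case
    using g insert.hyps
    by (intro exI[of _ "g(x := y)"]) (auto simp: inj_on_def)
qed

lemma constant_fibre_or_many_values:
  assumes "finite X" "p * p \<le> card X" "0 < p"
  shows "p \<le> card (d ` X) \<or> (\<exists>x. p \<le> card {v \<in> X. d v = x})"
proof (cases "p \<le> card (d ` X)")
  case False
  then have "(p - 1) * card (d ` X) \<le> (p - 1) * p" by (intro mult_left_mono) auto
  also have "\<dots> < p * p" using assms(3) by simp
  finally have "(p - 1) * card (d ` X) < card X" using assms(2) by simp
  then show ?thesis using pigeonhole_fibre[of X "d ` X" d "p - 1"] assms(1,3)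
    by (auto simp: Suc_le_eq) (metis Suc_leI Suc_pred assms(3))
qed simp

text \<open>
  A part with at least \<open>p\<close> degrees is called diverse, any other uniform; a uniform part \<open>i\<close> contains \<open>p\<close>
  vertices of degree \<open>x i\<close>. Suppose that at most \<open>q - 1\<close> parts are diverse and that each value of \<open>x\<close> is taken at most
  \<open>q - 1\<close> times. Among the \<open>(p - 1) * (q - 1) + 1\<close> parts, at least \<open>(p - 2) * (q - 1) + 1\<close> are then uniform, so
  \<open>x\<close> has at least \<open>p - 1\<close> values, and at least \<open>p\<close> if no part is diverse. A diverse part always supplies
  one more degree.
\<close>

lemma singular_copy_of_blowup:
  fixes F :: "'b sgraph" and G :: "'a sgraph"
  assumes F: "simple_graph F" and col: "proper_colouring F c q" and q: "1 \<le> q"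
    and p: "card (vertices F) = p" "2 \<le> p"
    and G: "simple_graph G"
    and X: "has_blowup (\<lambda>u v. {u, v} \<in> edges G) (vertices G) (Suc ((p - 1) * (q - 1))) (p * p) X"
  shows "\<exists>H. is_subgraph H G \<and> singular_in G H \<and> isomorphic_graphs F H"
proof -
  define r where "r = Suc ((p - 1) * (q - 1))"
  define d where "d = vertex_degree G"
  have fG: "finite (vertices G)" using G by (simp add: simple_graph_def)
  have fF: "finite (vertices F)" using F by (simp add: simple_graph_def)
  note XV = has_blowupD(1)[OF X, folded r_def] and Xc = has_blowupD(2)[OF X, folded r_def]
    and XE = has_blowupD(3)[OF X, folded r_def]
  have fX: "finite (X i)" if "i < r" for i using XV[OF that] fG finite_subset by blast
  have col_less: "c v < q" if "v \<in> vertices F" for v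
    using col that by (auto simp: proper_colouring_def)
  have col_neq: "c u \<noteq> c v" if "{u, v} \<in> edges F" for u v
    using col that simple_graph_edgeD[OF F that] by (auto simp: proper_colouring_def)
  \<comment> \<open>It suffices to distribute the vertices of \<open>F\<close> over the parts so that adjacent ones get
    different parts.\<close>
  have copyI: ?thesis
    if part: "\<And>v. v \<in> vertices F \<Longrightarrow> part v < r \<and> f v \<in> X (part v)"
      and neq: "\<And>u v. {u, v} \<in> edges F \<Longrightarrow> part u \<noteq> part v"
      and inj: "inj_on f (vertices F)"
      and sing: "(\<forall>u\<in>vertices F. \<forall>v\<in>vertices F. d (f u) = d (f v)) \<or> inj_on (d \<circ> f) (vertices F)"
    for part f
  proof -
    let ?H = "(f ` vertices F, (`) f ` edges F)"
    have sub: "f ` vertices F \<subseteq> vertices G"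
    proof (rule image_subsetI)
      fix v assume "v \<in> vertices F"
      then show "f v \<in> vertices G" using part[of v] XV[of "part v"] by auto
    qed
    have edge: "{f u, f v} \<in> edges G" if "{u, v} \<in> edges F" for u v
    proof -
      have "part u < r \<and> f u \<in> X (part u)" "part v < r \<and> f v \<in> X (part v)"
        using part simple_graph_edgeD(1,2)[OF F that] by auto
      then show ?thesis using XE[of "part u" "part v" "f u" "f v"] neq[OF that] by simp
    qed
    have "singular_in G ?H"
      using sing unfolding singular_in_def d_def inj_on_def by auto
    moreover have "is_subgraph ?H G" by (rule subgraph_copyI(1)[OF F inj sub edge])
    moreover have "isomorphic_graphs F ?H" by (rule subgraph_copyI(2)[OF F inj sub edge])
    ultimately show ?thesis by (intro exI[of _ ?H]) simp
  qed
  define diverse where "diverse = {i \<in> {..<r}. p \<le> card (d ` X i)}"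
  define uniform where "uniform = {..<r} - diverse"
  have fin: "finite diverse" "finite uniform" by (auto simp: diverse_def uniform_def)
  have "diverse \<union> uniform = {..<r}" by (auto simp: diverse_def uniform_def)
  moreover have "card (diverse \<union> uniform) = card diverse + card uniform"
    by (rule card_Un_disjoint[OF fin]) (auto simp: uniform_def)
  ultimately have total: "card diverse + card uniform = r" by simp
  have "\<exists>x. p \<le> card {v \<in> X i. d v = x}" if "i \<in> uniform" for i
    using constant_fibre_or_many_values[of "X i" p d] that fX[of i] Xc[of i] p(2)
    by (auto simp: uniform_def diverse_def)
  then obtain x where x: "\<And>i. i \<in> uniform \<Longrightarrow> p \<le> card {v \<in> X i. d v = x i}" by metis
  \<comment> \<open>\<open>p\<close> parts that offer pairwise distinct degrees carry a copy of the complete graph.\<close>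
  have cliqueI: ?thesis
    if J: "J \<subseteq> {..<r}" "card J = p" and yJ: "inj_on y J" "\<And>i. i \<in> J \<Longrightarrow> y i \<in> d ` X i" for J and y :: "nat \<Rightarrow> nat"
  proof -
    have "finite J" by (rule finite_subset[OF J(1)]) simp
    then obtain h where h: "bij_betw h (vertices F) J"
      using finite_same_card_bij[OF fF, of J] p(1) J(2) by auto
    have "\<forall>i\<in>J. \<exists>w. w \<in> X i \<and> d w = y i" using yJ(2) by fastforce
    from bchoice[OF this] obtain g where g: "\<forall>i\<in>J. g i \<in> X i \<and> d (g i) = y i" ..
    have hJ: "h v \<in> J" if "v \<in> vertices F" for v using h that by (auto simp: bij_betw_def)
    have "inj_on (y \<circ> h) (vertices F)"
      using h yJ(1) by (auto simp: bij_betw_def intro: comp_inj_on)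
    moreover have "d (g (h v)) = (y \<circ> h) v" if "v \<in> vertices F" for v using g hJ that by simp
    ultimately have dinj: "inj_on (d \<circ> (g \<circ> h)) (vertices F)" by (simp add: inj_on_def)
    show ?thesis
    proof (rule copyI[of h "g \<circ> h"])
      show "inj_on (g \<circ> h) (vertices F)" using dinj by (rule inj_on_imageI2[of d, unfolded o_assoc]) 
      show "h u \<noteq> h v" if "{u, v} \<in> edges F" for u v
        using h simple_graph_edgeD[OF F that] by (auto simp: bij_betw_def inj_on_def)
    qed (use hJ g J(1) dinj in auto)
  qed
  consider (diverse) "q \<le> card diverse"
    | (equal) z where "q \<le> card {i \<in> uniform. x i = z}"
    | (mixed) "card diverse < q" "\<And>z. card {i \<in> uniform. x i = z} < q"
    by (meson not_le)
  then show ?thesis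
  proof cases
    case diverse
    then obtain J where J: "J \<subseteq> diverse" "card J = q" by (meson obtain_subset_with_card_n)
    then have "finite J" using fin finite_subset by blast
    then obtain j where j: "bij_betw j {..<q} J" using J by (metis bij_betw_iff_card card_lessThan finite_lessThan)
    have jd: "j (c v) \<in> diverse" if "v \<in> vertices F" for v
      using j J col_less[OF that] by (auto simp: bij_betw_def)
    obtain y where y: "inj_on y (vertices F)" "\<forall>v\<in>vertices F. y v \<in> d ` X (j (c v))"
      using distinct_representatives[of "vertices F" "\<lambda>v. d ` X (j (c v))"] fF fX jd p(1)
      by (force simp: diverse_def)
    then have "\<forall>v\<in>vertices F. \<exists>w. w \<in> X (j (c v)) \<and> d w = y v" by fastforce
    from bchoice[OF this]
    obtain f where f: "\<forall>v\<in>vertices F. f v \<in> X (j (c v)) \<and> d (f v) = y v" ..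
    have dinj: "inj_on (d \<circ> f) (vertices F)" using y(1) f by (auto simp: inj_on_def)
    show ?thesis
    proof (rule copyI[of "j \<circ> c" f])
      show "inj_on f (vertices F)" using dinj by (rule inj_on_imageI2)
      show "(j \<circ> c) u \<noteq> (j \<circ> c) v" if "{u, v} \<in> edges F" for u v
        using j col_neq[OF that] col_less simple_graph_edgeD[OF F that]
        by (auto simp: bij_betw_def inj_on_def)
    qed (use f jd dinj in \<open>auto simp: diverse_def\<close>)
  next
    case (equal z)
    then obtain J where J: "J \<subseteq> {i \<in> uniform. x i = z}" "card J = q" by (meson obtain_subset_with_card_n)
    then have "finite J" using fin finite_subset by (metis (no_types, lifting) mem_Collect_eq subsetI)
    then obtain j where j: "bij_betw j {..<q} J" using J by (metis bij_betw_iff_card card_lessThan finite_lessThan)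
    define Y where "Y v = {w \<in> X (j (c v)). d w = z}" for v
    have jd: "j (c v) \<in> uniform" "p \<le> card (Y v)" "finite (Y v)" if "v \<in> vertices F" for v
    proof -
      have "j (c v) \<in> J" using j col_less[OF that] by (auto simp: bij_betw_def)
      then show "j (c v) \<in> uniform" "p \<le> card (Y v)" using J x[of "j (c v)"] by (auto simp: Y_def)
      then show "finite (Y v)" using fX by (auto simp: Y_def uniform_def)
    qed
    obtain f where f: "inj_on f (vertices F)" "\<forall>v\<in>vertices F. f v \<in> Y v"
      using distinct_representatives[of "vertices F" Y] fF jd p(1) by auto
    show ?thesis
    proof (rule copyI[of "j \<circ> c" f])
      show "(j \<circ> c) u \<noteq> (j \<circ> c) v" if "{u, v} \<in> edges F" for u v
        using j col_neq[OF that] col_less simple_graph_edgeD[OF F that]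
        by (auto simp: bij_betw_def inj_on_def)
    qed (use f jd in \<open>auto simp: Y_def uniform_def\<close>)
  next
    case mixed
    have xd: "x i \<in> d ` X i" if "i \<in> uniform" for i
    proof -
      have "{v \<in> X i. d v = x i} \<noteq> {}"
        using x[OF that] p(2) by (metis card.empty not_numeral_le_zero order_trans)
      then obtain v where "v \<in> X i" "d v = x i" by auto
      then show ?thesis by (metis imageI)
    qed
    \<comment> \<open>One uniform part for each value of \<open>x\<close>.\<close>
    obtain K where K: "K \<subseteq> uniform" "inj_on x K" "x ` K = x ` uniform"
      by (metis subset_image_inj order_refl)
    have cK: "card K = card (x ` uniform)" using K by (metis card_image)
    have "card uniform \<le> (q - 1) * card (x ` uniform)"
    proof (rule ccontr)
      assume "\<not> ?thesis"
      then obtain z where "q - 1 < card {i \<in> uniform. x i = z}"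
        using pigeonhole_fibre[of uniform "x ` uniform" x "q - 1"] fin by (auto simp: not_le)
      then show False using mixed(2)[of z] by simp
    qed
    then have le: "card uniform \<le> card K * (q - 1)" by (simp add: cK mult.commute)
    show ?thesis
    proof (cases "diverse = {}")
      case True
      then have "card diverse = 0" by simp
      then have "(p - 1) * (q - 1) < card K * (q - 1)" using le total unfolding r_def by linarith
      then have "p - 1 < card K" unfolding mult_less_cancel2 by simp
      then have "p \<le> card K" by simp
      then obtain J where J: "J \<subseteq> K" "card J = p" by (meson obtain_subset_with_card_n)
      then show ?thesis
        using K inj_on_subset[OF K(2) J(1)] xd
        by (intro cliqueI[of J x]) (auto simp: uniform_def)
    next
      case False
      then obtain i0 where i0: "i0 \<in> diverse" by auto
      have "p - 1 = Suc (p - 2)" using p(2) by simp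
      then have "(p - 1) * (q - 1) = (p - 2) * (q - 1) + (q - 1)" by (simp only: mult_Suc add.commute)
      then have "(p - 2) * (q - 1) < card K * (q - 1)"
        using le total mixed(1) unfolding r_def by linarith
      then have "p - 2 < card K" unfolding mult_less_cancel2 by simp
      then have "p - 1 \<le> card K" by simp
      then obtain J where J: "J \<subseteq> K" "card J = p - 1" by (meson obtain_subset_with_card_n)
      have fJ: "finite J" using J K fin by (meson finite_subset)
      have "card (x ` J) < card (d ` X i0)"
        using card_image_le[OF fJ, of x] J i0 p(2) by (auto simp: diverse_def)
      then have "\<not> d ` X i0 \<subseteq> x ` J"
        using card_mono[of "x ` J" "d ` X i0"] fJ by (meson finite_imageI not_le)
      then obtain y0 where y0: "y0 \<in> d ` X i0" "y0 \<notin> x ` J" by auto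
      have JU: "J \<subseteq> uniform" using J K by auto
      then have "i0 \<notin> J" using i0 by (auto simp: uniform_def)
      show ?thesis
      proof (rule cliqueI[of "insert i0 J" "x(i0 := y0)"])
        have eq: "(x(i0 := y0)) i = x i" if "i \<in> J" for i using \<open>i0 \<notin> J\<close> that by auto
        then have "(x(i0 := y0)) ` J = x ` J" by (intro image_cong) simp_all
        moreover have "inj_on (x(i0 := y0)) J"
          using inj_on_subset[OF K(2) J(1)] inj_on_cong[of J "x(i0 := y0)" x] eq by blast
        ultimately show "inj_on (x(i0 := y0)) (insert i0 J)"
          using \<open>i0 \<notin> J\<close> y0(2) by (simp add: inj_on_insert)
        show "insert i0 J \<subseteq> {..<r}"
          using i0 JU unfolding diverse_def uniform_def by blast
        show "card (insert i0 J) = p" using \<open>i0 \<notin> J\<close> fJ J(2) p(2) by simp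
        show "(x(i0 := y0)) i \<in> d ` X i" if "i \<in> insert i0 J" for i
        proof (cases "i = i0")
          case True
          then show ?thesis using y0(1) by simp
        next
          case False
          then have "i \<in> J" using that by simp
          then show ?thesis using eq[of i] xd[of i] JU by auto
        qed
      qed
    qed
  qed
qed

text \<open>
  Either \<open>p\<close> different degrees occur on \<open>S\<close>, or at most \<open>p - 1\<close> do, and then one of them occurs \<open>p\<close> times.
\<close>

lemma singular_clique_of_clique:
  fixes G :: "'a sgraph"
  assumes G: "simple_graph G" and S: "S \<subseteq> vertices G" "card S = Suc ((p - 1) * (p - 1))"
    and clique: "\<And>u v. u \<in> S \<Longrightarrow> v \<in> S \<Longrightarrow> u \<noteq> v \<Longrightarrow> {u, v} \<in> edges G"
    and p: "1 \<le> p"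
  shows "\<exists>H. is_subgraph H G \<and> singular_in G H \<and> isomorphic_graphs (complete_graph p) H"
proof -
  define d where "d = vertex_degree G"
  have fS: "finite S" using S(2) by (metis card.infinite nat.distinct(1))
  have "\<exists>T. T \<subseteq> S \<and> card T = p \<and> ((\<forall>u\<in>T. \<forall>v\<in>T. d u = d v) \<or> inj_on d T)"
  proof (cases "p \<le> card (d ` S)")
    case True
    obtain K where K: "K \<subseteq> S" "inj_on d K" "d ` K = d ` S" by (metis subset_image_inj order_refl)
    have "p \<le> card K" using True K by (metis card_image)
    then obtain T where "T \<subseteq> K" "card T = p" by (meson obtain_subset_with_card_n)
    then show ?thesis using K inj_on_subset by blast
  next
    case False
    then have "(p - 1) * card (d ` S) \<le> (p - 1) * (p - 1)" by (intro mult_left_mono) auto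
    then have "(p - 1) * card (d ` S) < card S" by (simp only: S(2) less_Suc_eq_le)
    then obtain z where "p - 1 < card {v \<in> S. d v = z}"
      using pigeonhole_fibre[of S "d ` S" d "p - 1"] fS by auto
    then have "p \<le> card {v \<in> S. d v = z}" by simp
    then obtain T where "T \<subseteq> {v \<in> S. d v = z}" "card T = p" by (meson obtain_subset_with_card_n)
    then show ?thesis by (intro exI[of _ T]) auto
  qed
  then obtain T where T: "T \<subseteq> S" "card T = p" "(\<forall>u\<in>T. \<forall>v\<in>T. d u = d v) \<or> inj_on d T" by blast
  have "finite T" using T(1) fS finite_subset by blast
  then obtain f where f: "bij_betw f {..<p} T" using T by (metis bij_betw_iff_card card_lessThan finite_lessThan)
  let ?F = "complete_graph p"
  note F = simple_complete_graph[of p]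
  let ?H = "(f ` vertices ?F, (`) f ` edges ?F)"
  have fV: "f ` vertices ?F = T" "inj_on f (vertices ?F)" using f by (auto simp: bij_betw_def complete_graph_def)
  have edge: "{f u, f v} \<in> edges G" if "{u, v} \<in> edges ?F" for u v
    using simple_graph_edgeD[OF F that] fV T(1) by (intro clique) (auto dest: inj_onD)
  have "singular_in G ?H"
    using T(3) fV(1) unfolding singular_in_def d_def inj_on_def by auto
  then show ?thesis
    using subgraph_copyI[OF F fV(2) _ edge] fV(1) T(1) S(1) by blast
qed

section \<open>Dense graphs without singular copies\<close>

text \<open>
  The relation \<open>adj\<close> describes a graph on \<open>V\<close> in which a vertex of group \<open>g\<close> has exactly \<open>D g\<close> non-neighbours
  (itself included), so that degrees and groups determine each other. It becomes a graph with
  \<open>n\<close> vertices by adding isolated ones. A singular copy of \<open>F\<close> either lies in one group, where \<open>col\<close> would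
  colour \<open>F\<close> with \<open>q - 1\<close> colours, or has at most one vertex in each of the \<open>p - 1\<close> groups. The added
  vertices cannot belong to a copy of \<open>F\<close> when \<open>F\<close> has no isolated vertex.
\<close>

lemma singular_turan_number_ge_blueprint:
  fixes F :: "'b sgraph" and V :: "'a set" and D :: "nat \<Rightarrow> nat"
  assumes F: "simple_graph F" "card (vertices F) = p" "chromatic_number F = q" "1 \<le> p" "1 \<le> q"
    and V: "finite V" "card V \<le> n"
    and sym: "\<And>u v. adj u v \<Longrightarrow> adj v u" and irrefl: "\<And>v. \<not> adj v v"
    and D: "\<And>v. v \<in> V \<Longrightarrow> card {u \<in> V. \<not> adj v u} = D (grp v)" "inj_on D {..<p - 1}"
    and M: "\<And>v. v \<in> V \<Longrightarrow> real (D (grp v)) \<le> M"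
    and grp: "\<And>v. v \<in> V \<Longrightarrow> grp v < p - 1"
    and col: "\<And>v. v \<in> V \<Longrightarrow> col v < q - 1"
      "\<And>u v. u \<in> V \<Longrightarrow> v \<in> V \<Longrightarrow> adj u v \<Longrightarrow> grp u = grp v \<Longrightarrow> col u \<noteq> col v"
    and isolated: "card V = n \<or> (\<forall>v\<in>vertices F. \<exists>e\<in>edges F. v \<in> e)"
  shows "real (card V) * (real (card V) - M) / 2 \<le> real (singular_turan_number n F)"
proof -
  define m where "m = card V"
  obtain b where b: "bij_betw b {..<m} V"
    using ex_bij_betw_nat_finite[OF V(1)] unfolding m_def atLeast0LessThan by blast
  have bV: "b i \<in> V" if "i < m" for i using b that by (auto simp: bij_betw_def)
  define adj' where "adj' i j \<longleftrightarrow> i < m \<and> j < m \<and> adj (b i) (b j)" for i j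
  define G where "G = graph_on {..<n} adj'"
  have VG: "vertices G = {..<n}" by (simp add: G_def)
  have G: "simple_graph G" unfolding G_def by (rule simple_graph_on) (auto simp: adj'_def irrefl)
  have "adj' j i" if "adj' i j" for i j using that sym unfolding adj'_def by blast
  then have "{i, j} \<in> edges G \<longleftrightarrow> i \<in> {..<n} \<and> j \<in> {..<n} \<and> adj' i j" for i j
    unfolding G_def by (rule edge_graph_on_iff)
  then have edge: "{i, j} \<in> edges G \<longleftrightarrow> i < m \<and> j < m \<and> adj (b i) (b j)" for i j
    using V(2) by (auto simp: adj'_def m_def)
  have deg: "vertex_degree G i = m - D (grp (b i))" and D_le: "D (grp (b i)) \<le> m" if i: "i < m" for i
  proof -
    have "b ` {j \<in> vertices G. {i, j} \<in> edges G} = {u \<in> V. adj (b i) u}"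
    proof (intro equalityI subsetI)
      fix u assume u: "u \<in> {u \<in> V. adj (b i) u}"
      then obtain j where "j < m" "u = b j" using b by (auto simp: bij_betw_def)
      then show "u \<in> b ` {j \<in> vertices G. {i, j} \<in> edges G}"
        using u i V(2) by (auto simp: edge VG m_def)
    qed (use bV in \<open>auto simp: edge\<close>)
    moreover have "inj_on b {j \<in> vertices G. {i, j} \<in> edges G}"
      by (rule inj_on_subset[of b "{..<m}"]) (use b in \<open>auto simp: bij_betw_def edge\<close>)
    then have "card (b ` {j \<in> vertices G. {i, j} \<in> edges G}) = vertex_degree G i"
      unfolding vertex_degree_eq_card_neighbours[OF G] by (rule card_image)
    ultimately have d: "vertex_degree G i = card {u \<in> V. adj (b i) u}" by simp
    have "card ({u \<in> V. adj (b i) u} \<union> {u \<in> V. \<not> adj (b i) u})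
        = card {u \<in> V. adj (b i) u} + card {u \<in> V. \<not> adj (b i) u}"
      using V(1) by (intro card_Un_disjoint) auto
    moreover have "{u \<in> V. adj (b i) u} \<union> {u \<in> V. \<not> adj (b i) u} = V" by auto
    ultimately have "m = vertex_degree G i + D (grp (b i))"
      using d D(1)[OF bV[OF i]] by (simp add: m_def)
    then show "vertex_degree G i = m - D (grp (b i))" "D (grp (b i)) \<le> m" by simp_all
  qed
  have grp_eq: "grp (b i) = grp (b j)" if "i < m" "j < m" "vertex_degree G i = vertex_degree G j" for i j
  proof -
    have "D (grp (b i)) = D (grp (b j))" using deg D_le that by (metis diff_diff_cancel)
    then show ?thesis using inj_onD[OF D(2)] grp bV that by auto
  qed
  have "\<not> (\<exists>H. is_subgraph H G \<and> singular_in G H \<and> isomorphic_graphs F H)"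
  proof
    assume "\<exists>H. is_subgraph H G \<and> singular_in G H \<and> isomorphic_graphs F H"
    then obtain H where H: "is_subgraph H G" "singular_in G H" "isomorphic_graphs F H" by blast
    obtain f where f: "inj_on f (vertices F)" "f ` vertices F = vertices H"
        "vertices H \<subseteq> vertices G" and fe: "\<And>u v. {u, v} \<in> edges F \<Longrightarrow> {f u, f v} \<in> edges G"
      using subgraph_copyE[OF H(1,3)] by metis
    \<comment> \<open>The copy avoids the isolated vertices of \<open>G\<close>.\<close>
    have fm: "f v < m" if v: "v \<in> vertices F" for v
      using isolated
    proof
      assume "card V = n"
      then show ?thesis using f v by (auto simp: VG m_def)
    next
      assume "\<forall>v\<in>vertices F. \<exists>e\<in>edges F. v \<in> e"
      then obtain e where e: "e \<in> edges F" "v \<in> e" using v by auto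
      then obtain w where "e = {v, w}" using edge_doubleton[OF F(1)] by blast
      then show ?thesis using e fe[of v w] by (auto simp: edge)
    qed
    from H(2) show False
      unfolding singular_in_def
    proof
      assume eq: "\<forall>u\<in>vertices H. \<forall>v\<in>vertices H. vertex_degree G u = vertex_degree G v"
      have same: "grp (b (f u)) = grp (b (f v))" if "u \<in> vertices F" "v \<in> vertices F" for u v
        using that eq f(2) by (intro grp_eq fm) auto
      have "proper_colouring F (\<lambda>v. col (b (f v))) (q - 1)"
        unfolding proper_colouring_def
      proof (intro conjI ballI impI)
        show "(\<lambda>v. col (b (f v))) ` vertices F \<subseteq> {..<q - 1}" using fm bV col(1) by auto
      next
        fix u v assume uv: "u \<in> vertices F" "v \<in> vertices F" "{u, v} \<in> edges F"
        then have "adj (b (f u)) (b (f v))" using fe[OF uv(3)] by (simp add: edge)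
        then show "col (b (f u)) \<noteq> col (b (f v))"
          by (rule col(2)[OF bV[OF fm[OF uv(1)]] bV[OF fm[OF uv(2)]] _ same[OF uv(1,2)]])
      qed
      then have "chromatic_number F \<le> q - 1"
        unfolding chromatic_number_def by (intro Least_le exI)
      then show False using F(3,5) by simp
    next
      assume neq: "\<forall>u\<in>vertices H. \<forall>v\<in>vertices H. u \<noteq> v \<longrightarrow> vertex_degree G u \<noteq> vertex_degree G v"
      have "inj_on (\<lambda>v. grp (b (f v))) (vertices F)"
      proof (rule inj_onI)
        fix u v assume uv: "u \<in> vertices F" "v \<in> vertices F" "grp (b (f u)) = grp (b (f v))"
        then have "vertex_degree G (f u) = vertex_degree G (f v)" using deg[OF fm] uv by simp
        moreover have "f u \<in> vertices H" "f v \<in> vertices H" using f(2) uv by auto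
        ultimately have "f u = f v" using neq by blast
        then show "u = v" using f(1) uv by (auto dest: inj_onD)
      qed
      moreover have "(\<lambda>v. grp (b (f v))) ` vertices F \<subseteq> {..<p - 1}" using fm bV grp by auto
      ultimately have "card (vertices F) \<le> card {..<p - 1}" by (intro card_inj_on_le) auto
      then show False using F(2,4) by simp
    qed
  qed
  then have "card (edges G) \<le> singular_turan_number n F"
    using G by (intro card_edges_le_singular_turan_number) (auto simp: VG)
  moreover have "real m * (real m - M) \<le> 2 * real (card (edges G))"
  proof -
    have "real m * (real m - M) = (\<Sum>i<m. real m - M)" by simp
    also have "\<dots> \<le> (\<Sum>i<m. real (vertex_degree G i))"
    proof (intro sum_mono)
      fix i assume "i \<in> {..<m}"
      then show "real m - M \<le> real (vertex_degree G i)"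
        using M[OF bV, of i] deg D_le by (simp add: of_nat_diff)
    qed
    also have "\<dots> \<le> (\<Sum>i\<in>vertices G. real (vertex_degree G i))"
      using V(2) by (intro sum_mono2) (auto simp: VG m_def)
    also have "\<dots> = real (2 * card (edges G))"
      by (simp only: handshake[OF G, symmetric] of_nat_sum)
    finally show ?thesis by simp
  qed
  ultimately show ?thesis unfolding m_def by linarith
qed

text \<open>
  The blueprint used below: part \<open>c\<close> of group \<open>g\<close> has \<open>d g\<close> vertices, except that part 0 of group 0 has only
  \<open>s0\<close> and part 0 of group 1 only \<open>s1\<close>. The vertices of these two parts make up for the missing
  non-neighbours in their own part by the pairs in \<open>R\<close>, which are deleted between the two parts.
\<close>

lemma singular_turan_number_ge_multipartite:
  fixes F :: "'b sgraph" and d :: "nat \<Rightarrow> nat"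
  assumes F: "simple_graph F" "card (vertices F) = p" "chromatic_number F = q" "3 \<le> p" "2 \<le> q"
    and d: "inj_on d {..<p - 1}" "\<And>g. g < p - 1 \<Longrightarrow> real (d g) \<le> M"
    and s: "d 0 = s0 + x" "d 1 = s1 + y"
    and R: "\<And>i. i < s0 \<Longrightarrow> card {j \<in> {..<s1}. R i j} = x"
      "\<And>j. j < s1 \<Longrightarrow> card {i \<in> {..<s0}. R i j} = y"
    and N: "N + (x + y) = (q - 1) * (\<Sum>g<p - 1. d g)" "N \<le> n"
      "N = n \<or> (\<forall>v\<in>vertices F. \<exists>e\<in>edges F. v \<in> e)"
  shows "real N * (real N - M) / 2 \<le> real (singular_turan_number n F)"
proof -
  define parts where "parts = {..<p - 1} \<times> {..<q - 1}"
  define \<sigma> :: "nat \<times> nat \<Rightarrow> nat" where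
    "\<sigma> a = (if a = (0, 0) then s0 else if a = (1, 0) then s1 else d (fst a))" for a
  define V where "V = Sigma parts (\<lambda>a. {..<\<sigma> a})"
  define E :: "(nat \<times> nat) \<times> nat \<Rightarrow> (nat \<times> nat) \<times> nat \<Rightarrow> bool" where
    "E u v \<longleftrightarrow> fst u \<noteq> fst v \<and>
       \<not> (fst u = (0, 0) \<and> fst v = (1, 0) \<and> R (snd u) (snd v)) \<and>
       \<not> (fst u = (1, 0) \<and> fst v = (0, 0) \<and> R (snd v) (snd u))" for u v
  have base: "(0, 0) \<in> parts" "(1, 0) \<in> parts" using F by (auto simp: parts_def)
  have finp: "finite parts" by (simp add: parts_def)
  have s2: "d (Suc 0) = s1 + y" using s(2) by simp
  have cV: "card V = N"
  proof -
    have "card V + (x + y) = (\<Sum>a\<in>parts. \<sigma> a) + (\<Sum>a\<in>parts. (if a = (0, 0) then x else 0) + (if a = (1, 0) then y else 0))"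
      using base finp by (simp add: V_def sum.distrib)
    also have "\<dots> = (\<Sum>a\<in>parts. d (fst a))"
      unfolding sum.distrib[symmetric] by (intro sum.cong refl) (auto simp: \<sigma>_def s(1) s2)
    also have "\<dots> = (\<Sum>g<p - 1. \<Sum>c<q - 1. d g)"
      unfolding parts_def by (subst sum.cartesian_product) (simp add: case_prod_unfold)
    also have "\<dots> = (q - 1) * (\<Sum>g<p - 1. d g)" by (simp add: sum_distrib_left)
    finally show ?thesis using N(1) by simp
  qed
  have "real (card V) * (real (card V) - M) / 2 \<le> real (singular_turan_number n F)"
  proof (rule singular_turan_number_ge_blueprint[of F p q V n E d "\<lambda>v. fst (fst v)" M "\<lambda>v. snd (fst v)"])
    show "finite V" by (simp add: V_def finp)
    show "card V \<le> n" "card V = n \<or> (\<forall>v\<in>vertices F. \<exists>e\<in>edges F. v \<in> e)" using N cV by auto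
    show "E v u" if "E u v" for u v using that by (auto simp: E_def)
    show "\<not> E v v" for v by (simp add: E_def)
    show "card {u \<in> V. \<not> E v u} = d (fst (fst v))" if v: "v \<in> V" for v
    proof -
      obtain a i where ai: "v = (a, i)" "a \<in> parts" "i < \<sigma> a" using v by (auto simp: V_def)
      let ?S = "{a} \<times> {..<\<sigma> a}"
      consider "a = (0, 0)" | "a = (1, 0)" | "a \<noteq> (0, 0)" "a \<noteq> (1, 0)" by blast
      then show ?thesis
      proof cases
        case 1
        have "{u \<in> V. \<not> E v u} = ?S \<union> {(1, 0)} \<times> {j \<in> {..<s1}. R i j}"
          using ai 1 base by (auto simp: V_def E_def \<sigma>_def)
        also have "card \<dots> = card ?S + card ({(1 :: nat, 0 :: nat)} \<times> {j \<in> {..<s1}. R i j})"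
          using 1 by (intro card_Un_disjoint) auto
        finally show ?thesis using ai 1 R(1)[of i] by (simp add: \<sigma>_def s card_cartesian_product)
      next
        case 2
        have "{u \<in> V. \<not> E v u} = ?S \<union> {(0, 0)} \<times> {j \<in> {..<s0}. R j i}"
          using ai 2 base by (auto simp: V_def E_def \<sigma>_def)
        also have "card \<dots> = card ?S + card ({(0 :: nat, 0 :: nat)} \<times> {j \<in> {..<s0}. R j i})"
          using 2 by (intro card_Un_disjoint) auto
        finally show ?thesis using ai 2 R(2)[of i] s2 by (simp add: \<sigma>_def card_cartesian_product)
      next
        case 3
        have "{u \<in> V. \<not> E v u} = ?S"
          using ai 3 by (auto simp: V_def E_def)
        then show ?thesis using ai 3 by (simp add: \<sigma>_def card_cartesian_product)
      qed
    qed
    show "inj_on d {..<p - 1}" by (rule d(1))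
    show grp: "fst (fst v) < p - 1" "snd (fst v) < q - 1" if "v \<in> V" for v
      using that by (auto simp: V_def parts_def)
    show "real (d (fst (fst v))) \<le> M" if "v \<in> V" for v by (rule d(2)[OF grp(1)[OF that]])
    show "snd (fst u) \<noteq> snd (fst v)" if "E u v" "fst (fst u) = fst (fst v)" for u v
    proof -
      have "fst u \<noteq> fst v" using that(1) by (simp add: E_def)
      then show ?thesis using that(2) by (metis prod.expand)
    qed
  qed (use F in simp_all)
  then show ?thesis by (simp add: cV)
qed

lemma card_congruent_below:
  fixes a k i :: nat
  assumes "0 < k"
  shows "card {j \<in> {..<a * k}. i mod k = j mod k} = a"
proof -
  have "bij_betw (\<lambda>t. t * k + i mod k) {..<a} {j \<in> {..<a * k}. i mod k = j mod k}"
  proof (rule bij_betwI[where g = "\<lambda>j. j div k"])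
    show "(\<lambda>t. t * k + i mod k) \<in> {..<a} \<rightarrow> {j \<in> {..<a * k}. i mod k = j mod k}"
    proof
      fix t assume "t \<in> {..<a}"
      then have "(t + 1) * k \<le> a * k" by (intro mult_right_mono) auto
      moreover have "i mod k < k" using assms by simp
      ultimately have "t * k + i mod k < a * k" by simp
      then show "t * k + i mod k \<in> {j \<in> {..<a * k}. i mod k = j mod k}" using assms by simp
    qed
    show "(\<lambda>j. j div k) \<in> {j \<in> {..<a * k}. i mod k = j mod k} \<rightarrow> {..<a}"
      by (auto simp: less_mult_imp_div_less)
    show "(t * k + i mod k) div k = t" for t using assms by simp
    show "j div k * k + i mod k = j" if "j \<in> {j \<in> {..<a * k}. i mod k = j mod k}" for j
      using that by simp
  qed
  then show ?thesis by (metis bij_betw_same_card card_lessThan)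
qed

text \<open>
  Nearly equal distinct summands: \<open>J\<close> consecutive numbers, the last one enlarged by the remainder.
\<close>

lemma distinct_summands:
  assumes "1 \<le> J" "J * (L + J) \<le> T"
  shows "\<exists>e :: nat \<Rightarrow> nat. inj_on e {..<J} \<and> (\<Sum>i<J. e i) = T \<and>
    (\<forall>i<J. L < e i \<and> J * e i \<le> T + 2 * (J * J))"
proof -
  define S where "S = (\<Sum>i<J. i)"
  have "S \<le> (\<Sum>i<J. J - 1)" unfolding S_def by (intro sum_mono) auto
  then have S: "S \<le> J * (J - 1)" by simp
  have JJ: "J * J = J * (J - 1) + J" using assms(1) by (cases J) auto
  define w where "w = T - S"
  have T: "T = w + S" using S assms(2) JJ by (simp add: w_def distrib_left)
  define e where "e i = w div J + i + (if i = J - 1 then w mod J else 0)" for i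
  have "J * (L + 1) \<le> w" using assms(2) S T JJ by (simp add: distrib_left)
  then have L: "L < w div J"
    using assms(1) by (metis Suc_eq_plus1 Suc_le_eq div_le_mono nonzero_mult_div_cancel_left not_one_le_zero)
  have "inj_on e {..<J}" by (auto simp: inj_on_def e_def split: if_splits)
  moreover have "(\<Sum>i<J. e i) = T"
  proof -
    have "(\<Sum>i<J. e i) = J * (w div J) + S + w mod J"
      using assms(1) by (simp add: e_def sum.distrib S_def)
    also have "\<dots> = T" using T mult_div_mod_eq[of J w] by linarith
    finally show ?thesis .
  qed
  moreover have "L < e i \<and> J * e i \<le> T + 2 * (J * J)" if "i < J" for i
  proof
    show "L < e i" using L by (simp add: e_def)
    have "w mod J < J" using assms(1) by simp
    then have "(if i = J - 1 then w mod J else 0) \<le> J" by simp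
    then have "e i \<le> w div J + 2 * J" using that unfolding e_def by linarith
    then have "J * e i \<le> J * (w div J + 2 * J)" by (rule mult_left_mono) simp
    also have "\<dots> \<le> w + 2 * (J * J)" by (simp add: distrib_left)
    finally show "J * e i \<le> T + 2 * (J * J)" using T by simp
  qed
  ultimately show ?thesis by blast
qed

text \<open>
  Two groups, with parts of sizes \<open>d 0\<close> and \<open>d 1\<close>; the remaining \<open>n mod (q - 1)\<close> vertices are isolated. There are
  none of these if \<open>q = 2\<close>, and for \<open>q = 3\<close> the graph \<open>F\<close> is a triangle.
\<close>

lemma singular_turan_number_ge_three:
  fixes F :: "'b sgraph"
  assumes F: "simple_graph F" "card (vertices F) = 3" "chromatic_number F = q" "2 \<le> q"
    and n: "4 * q \<le> n"
  shows "\<exists>N. N \<le> n \<and> n \<le> N + q \<and>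
    real N * (real N - (real n / real (2 * (q - 1)) + 4)) / 2 \<le> real (singular_turan_number n F)"
proof -
  define Q where "Q = q - 1"
  have q3: "q \<le> 3" using chromatic_number_bounds(2)[OF F(1)] F by simp
  define T where "T = n div Q"
  have Q: "1 \<le> Q" using F(4) by (simp add: Q_def)
  have "4 * Q \<le> n" using n by (simp add: Q_def)
  then have T4: "4 \<le> T" unfolding T_def using Q by (simp add: less_eq_div_iff_mult_less_eq)
  then obtain d :: "nat \<Rightarrow> nat" where d: "inj_on d {..<2}" "(\<Sum>i<2. d i) = T" "\<forall>i<2. 2 * d i \<le> T + 2 * (2 * 2)"
    using distinct_summands[of 2 0 T] by auto
  have NT: "Q * T \<le> n" "n < Q * T + Q"
    unfolding T_def using dividend_less_times_div[of Q n] Q by simp_all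
  have N: "Q * T = n \<or> (\<forall>v\<in>vertices F. \<exists>e\<in>edges F. v \<in> e)"
  proof (cases "q = 3")
    case True
    have "\<exists>e\<in>edges F. v \<in> e" if v: "v \<in> vertices F" for v
    proof -
      have "vertices F \<noteq> {v}" using F(2) by auto
      then obtain w where "w \<in> vertices F" "w \<noteq> v" using v by blast
      then have "{v, w} \<in> edges F" using chromatic_number_bounds(3)[OF F(1)] F v True by simp
      then show ?thesis by blast
    qed
    then show ?thesis by blast
  next
    case False
    then have "Q = 1" using q3 F(4) by (simp add: Q_def)
    then show ?thesis by (simp add: T_def)
  qed
  have "real (Q * T) * (real (Q * T) - (real n / real (2 * (q - 1)) + 4)) / 2
      \<le> real (singular_turan_number n F)"
  proof (rule singular_turan_number_ge_multipartite[OF F(1,2,3) _ F(4),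
        where d = d and ?s0.0 = "d 0" and ?s1.0 = "d 1" and x = 0 and y = 0 and R = "\<lambda>_ _. False"])
    show "real (d g) \<le> real n / real (2 * (q - 1)) + 4" if "g < 3 - 1" for g
    proof -
      have "2 * d g \<le> T + 8" using d(3) that by simp
      moreover have "real T \<le> real n / real Q" unfolding T_def by (rule of_nat_div_le_of_nat)
      ultimately show ?thesis unfolding Q_def[symmetric] by (simp add: field_simps)
    qed
    have "(3::nat) - 1 = 2" by simp
    then show "inj_on d {..<3 - 1}" using d(1) by simp
    show "Q * T + (0 + 0) = (q - 1) * (\<Sum>g<3 - 1. d g)" using d(2) by (simp add: Q_def)
    show "d 0 = d 0 + 0" "d 1 = d 1 + 0" by simp_all
    show "card {j \<in> {..<d 1}. False} = 0" "card {i \<in> {..<d 0}. False} = 0" by simp_all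
    show "Q * T \<le> n" by (rule NT)
    show "Q * T = n \<or> (\<forall>v\<in>vertices F. \<exists>e\<in>edges F. v \<in> e)" by (rule N)
  qed simp
  then show ?thesis using NT by (intro exI[of _ "Q * T"]) (simp add: Q_def)
qed

text \<open>
  With \<open>Q = q - 1\<close>, the two special parts have \<open>A * k\<close> and \<open>A' * k\<close> vertices, and two vertices from them are
  non-adjacent if their indices agree modulo \<open>k\<close>: each vertex loses \<open>A'\<close> or \<open>A\<close> neighbours. The parts of the first two
  groups thus have nominal sizes \<open>d0 = A * k + A'\<close> and \<open>d1 = A' * k + A\<close>. Choosing \<open>A\<close> and \<open>A'\<close> of order \<open>sqrt n\<close> and
  differing by at most \<open>Q\<close> makes \<open>d0\<close> and \<open>d1\<close> equal up to \<open>O(sqrt n)\<close>; the difference \<open>\<rho>\<close> is chosen so that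
  \<open>n + A + A'\<close> is a multiple of \<open>Q\<close>. The other \<open>p - 3\<close> groups, of which there is at least one, absorb the rest: \<open>k\<close> is
  so small that \<open>d0\<close> and \<open>d1\<close> do not exceed \<open>n div s\<close>, while the remaining sizes are larger than that, which keeps
  all sizes distinct.
\<close>

lemma singular_turan_number_ge_four:
  fixes F :: "'b sgraph"
  assumes F: "simple_graph F" "card (vertices F) = p" "chromatic_number F = q" "4 \<le> p" "2 \<le> q"
    and r: "r * r \<le> n" "n < (r + 1) * (r + 1)"
    and big: "(p - 1) * (q - 1) * (6 * (q - 1) + 1) + (p - 3) * (p - 3) \<le> r"
  shows "real n * (real n - (real n / real ((p - 1) * (q - 1)) + real (8 * q + 9 + 2 * p * p) * real r)) / 2
    \<le> real (singular_turan_number n F)"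
proof -
  define P Q J where "P = p - 1" and "Q = q - 1" and "J = p - 3"
  have P: "P = J + 2" "1 \<le> J" "1 \<le> Q" using F by (simp_all add: P_def Q_def J_def)
  define s where "s = P * Q"
  have s: "1 \<le> s" using P by (simp add: s_def)
  have r1: "1 \<le> r" "J * J \<le> r" "s * (6 * Q + 1) \<le> r"
  proof -
    have le: "s * (6 * Q + 1) + J * J \<le> r" using big by (simp only: s_def P_def Q_def J_def)
    have "s * 1 \<le> s * (6 * Q + 1)" by (rule mult_left_mono) simp_all
    then show "1 \<le> r" "J * J \<le> r" "s * (6 * Q + 1) \<le> r" using le s by linarith+
  qed
  define B where "B = n div s"
  define \<rho> where "\<rho> = Q - n mod Q"
  have rho: "1 \<le> \<rho>" "\<rho> \<le> Q" using P by (simp_all add: \<rho>_def Suc_leI)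
  define A A' where "A = Q * r" and "A' = Q * r + \<rho>"
  define Z where "Z = n div Q + 1 + 2 * r"
  have QZ: "n + (A' + A) = Q * Z"
  proof -
    have "n mod Q < Q" using P(3) by simp
    then have "n + \<rho> = Q * (n div Q) + Q" using mult_div_mod_eq[of Q n] unfolding \<rho>_def by linarith
    then show ?thesis by (simp add: A_def A'_def Z_def algebra_simps)
  qed
  define k where "k = B div A' - 1"
  have A'pos: "1 \<le> A'" using rho by (simp add: A'_def)
  have A'_le: "A' \<le> Q * r + Q" using rho by (simp add: A'_def)
  have B3: "3 * A' \<le> B"
  proof -
    have "Q * 1 \<le> Q * r" using r1(1) by (rule mult_left_mono) simp
    moreover have "(6 * Q + 1) * r = 6 * (Q * r) + r" by (simp add: algebra_simps)
    ultimately have "3 * A' \<le> (6 * Q + 1) * r" using A'_le by linarith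
    then have "s * (3 * A') \<le> s * ((6 * Q + 1) * r)" by (rule mult_left_mono) simp
    also have "\<dots> = (s * (6 * Q + 1)) * r" by (simp only: mult.assoc)
    also have "\<dots> \<le> r * r" using r1(3) by (rule mult_right_mono) simp
    also have "\<dots> \<le> n" by (rule r)
    finally show ?thesis unfolding B_def using s by (simp add: less_eq_div_iff_mult_less_eq mult.commute)
  qed
  then have "3 \<le> B div A'" using A'pos by (simp add: less_eq_div_iff_mult_less_eq)
  then have k: "2 \<le> k" "B div A' = k + 1" by (simp_all add: k_def)
  have kB: "A' * (k + 1) \<le> B" "B < A' * (k + 2)"
  proof -
    show "A' * (k + 1) \<le> B" using times_div_less_eq_dividend[of A' B] k(2) by simp
    have "B < A' + A' * (B div A')" using A'pos by (intro dividend_less_times_div) simp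
    then show "B < A' * (k + 2)" by (simp add: k(2))
  qed
  define d0 d1 where "d0 = A * k + A'" and "d1 = A' * k + A"
  have AA: "A' = A + \<rho>" by (simp add: A_def A'_def)
  have d_le: "d0 \<le> B" "d1 \<le> B"
    using kB(1) unfolding d0_def d1_def AA by (simp_all add: algebra_simps)
  have "d1 + \<rho> = d0 + \<rho> * k" unfolding d0_def d1_def AA by (simp add: algebra_simps)
  moreover have "\<rho> * 2 \<le> \<rho> * k" using k(1) by (rule mult_left_mono) simp
  ultimately have d_neq: "d0 < d1" using rho(1) by linarith
  define T where "T = Z - (d0 + d1)"
  have PB: "P * B \<le> n div Q"
  proof -
    have "B * s \<le> n" unfolding B_def by simp
    then have "P * B * Q \<le> n" by (simp add: s_def mult_ac)
    then show ?thesis using P by (simp add: less_eq_div_iff_mult_less_eq)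
  qed
  then have "J * B + 2 * B + 1 + 2 * r \<le> Z" by (simp add: Z_def P algebra_simps)
  then have ZT: "Z = T + (d0 + d1)" and "J * B + J * J \<le> T"
    using d_le r1(2) unfolding T_def by linarith+
  then obtain e where e: "inj_on e {..<J}" "(\<Sum>i<J. e i) = T"
    "\<forall>i<J. B < e i \<and> J * e i \<le> T + 2 * (J * J)"
    using distinct_summands[of J B T] P(2) by (auto simp: distrib_left)
  define d where "d g = (if g = 0 then d0 else if g = 1 then d1 else e (g - 2))" for g :: nat
  define M where "M = real n / real s + real (8 * q + 9 + 2 * p * p) * real r"
  have B_le: "real B \<le> real n / real s" unfolding B_def by (rule of_nat_div_le_of_nat)
  have e_le: "real (e i) \<le> M" if "i < J" for i
  proof -
    have "Q * k * r \<le> A' * (k + 1)" unfolding A'_def by (simp add: algebra_simps)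
    also have "\<dots> \<le> n" using kB(1) unfolding B_def by (meson div_le_dividend le_trans)
    also have "\<dots> \<le> (r + 1) * (r + 1)" using r(2) by simp
    also have "\<dots> \<le> (2 * r) * (2 * r)" using r1(1) by (intro mult_mono) auto
    finally have "(Q * k) * r \<le> (4 * r) * r" by simp
    then have Qk: "Q * k \<le> 4 * r" using r1(1) by simp
    have "\<rho> * k \<le> Q * k" using rho(2) by (rule mult_right_mono) simp
    moreover have "d0 + \<rho> * k = A' * k + A'" "A' * k + 2 * A' = A' * (k + 2)"
      unfolding d0_def AA by (simp_all add: algebra_simps)
    ultimately have "2 * B \<le> d0 + d1 + 4 * A' + 4 * r"
      using kB(2) Qk unfolding d1_def by linarith
    moreover have "4 * A' \<le> 4 * (Q * r + Q)" using A'_le by (rule mult_left_mono) simp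
    ultimately have TB: "T + 2 * B \<le> Z + 4 * (Q * r + Q) + 4 * r" unfolding ZT by simp
    have "J * e i \<le> T + 2 * (J * J)" using e(3) that by blast
    then have nat_le: "J * e i + 2 * B \<le> n div Q + 1 + 6 * r + 4 * (Q * r) + 4 * Q + 2 * (J * J)"
      using TB unfolding Z_def by simp
    have B_gt: "real n / real s - 1 \<le> real B"
    proof -
      have "n < s + s * B" using dividend_less_times_div[of s n] s by (simp add: B_def)
      then have "real n \<le> real (s + s * B)" by (simp only: of_nat_le_iff less_imp_le)
      then show ?thesis using s by (simp add: field_simps)
    qed
    have "0 < P" using P(1) by simp
    have "real (n div Q) \<le> real n / real Q" by (rule of_nat_div_le_of_nat)
    also have "real n / real Q = real P * (real n / real s)" using \<open>0 < P\<close> by (simp add: s_def)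
    also have "real P = real J + 2" using P(1) by simp
    finally have "real (n div Q) \<le> real J * (real n / real s) + 2 * (real n / real s)"
      by (simp only: distrib_right)
    moreover have "real J * real (e i) + 2 * real B
        \<le> real (n div Q) + real (1 + 6 * r + 4 * (Q * r) + 4 * Q + 2 * (J * J))"
      using of_nat_mono[OF nat_le, where 'a = real]
      by (simp only: of_nat_add of_nat_mult of_nat_numeral add.assoc)
    moreover have "real (3 + 6 * r + 4 * (Q * r) + 4 * Q + 2 * (J * J))
        = real (1 + 6 * r + 4 * (Q * r) + 4 * Q + 2 * (J * J)) + 2" by simp
    ultimately have "real J * real (e i) \<le> real J * (real n / real s)
        + real (3 + 6 * r + 4 * (Q * r) + 4 * Q + 2 * (J * J))"
      using B_gt by linarith
    also have "3 + 6 * r + 4 * (Q * r) + 4 * Q + 2 * (J * J) \<le> (8 * q + 9 + 2 * p * p) * r"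
    proof -
      have "4 * Q \<le> 4 * (Q * r)" using r1(1) by simp
      moreover have "J * J * 1 \<le> p * p * r" unfolding J_def using r1(1) by (intro mult_mono) auto
      moreover have "Q * r \<le> q * r" by (simp add: Q_def)
      moreover have "(8 * q + 9 + 2 * p * p) * r = 8 * (q * r) + 9 * r + 2 * (p * p * r)"
        by (simp add: algebra_simps)
      ultimately show ?thesis using r1(1) by linarith
    qed
    also have "real ((8 * q + 9 + 2 * p * p) * r) \<le> real J * real ((8 * q + 9 + 2 * p * p) * r)"
    proof -
      have "1 * real ((8 * q + 9 + 2 * p * p) * r) \<le> real J * real ((8 * q + 9 + 2 * p * p) * r)"
        using P(2) by (intro mult_right_mono) simp_all
      then show ?thesis by (simp only: mult_1)
    qed
    finally have "real J * real (e i) \<le> real J * M" by (simp add: M_def algebra_simps)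
    then show ?thesis using P(2) by simp
  qed
  have "real n * (real n - M) / 2 \<le> real (singular_turan_number n F)"
  proof (rule singular_turan_number_ge_multipartite[OF F(1,2,3) _ F(5),
        where d = d and ?s0.0 = "A * k" and ?s1.0 = "A' * k" and x = A' and y = A
          and R = "\<lambda>i j. i mod k = j mod k"])
    show "inj_on d {..<p - 1}"
    proof (rule inj_onI)
      fix g h assume gh: "g \<in> {..<p - 1}" "h \<in> {..<p - 1}" "d g = d h"
      have large: "B < d g \<longleftrightarrow> 2 \<le> g" if "g < p - 1" for g
        using that d_le e(3) by (auto simp: d_def J_def not_less)
      have gh': "g < p - 1" "h < p - 1" using gh by simp_all
      have iff: "2 \<le> g \<longleftrightarrow> 2 \<le> h" using large[OF gh'(1)] large[OF gh'(2)] gh(3) by simp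
      show "g = h"
      proof (cases "2 \<le> g")
        case True
        then have "2 \<le> h" using iff by simp
        moreover from this have "e (g - 2) = e (h - 2)" using gh(3) True by (simp add: d_def)
        moreover have "g - 2 \<in> {..<J}" "h - 2 \<in> {..<J}" using gh' True iff by (auto simp: J_def)
        ultimately have "g - 2 = h - 2" using inj_onD[OF e(1)] by blast
        then show ?thesis using True \<open>2 \<le> h\<close> by simp
      next
        case False
        then have "g = 0 \<or> g = 1" "h = 0 \<or> h = 1" using iff by auto
        then show ?thesis using gh(3) d_neq by (auto simp: d_def)
      qed
    qed
    show "real (d g) \<le> M" if "g < p - 1" for g
    proof (cases "2 \<le> g")
      case True
      then show ?thesis using e_le[of "g - 2"] that by (simp add: d_def J_def)
    next
      case False
      then have "d g \<le> B" using d_le by (auto simp: d_def)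
      then have "real (d g) \<le> real n / real s" using B_le by linarith
      then show ?thesis unfolding M_def by (simp add: add_increasing2)
    qed
    show "n + (A' + A) = (q - 1) * (\<Sum>g<p - 1. d g)"
    proof -
      have "(\<Sum>g<p - 1. d g) = d0 + d1 + (\<Sum>i<J. e i)"
        using P(1) unfolding P_def[symmetric]
        by (simp add: sum.lessThan_Suc_shift d_def del: sum.lessThan_Suc)
      then show ?thesis using QZ ZT e(2) by (simp add: Q_def)
    qed
    show "card {j \<in> {..<A' * k}. i mod k = j mod k} = A'" for i
      using k(1) by (intro card_congruent_below) simp
    show "card {i \<in> {..<A * k}. i mod k = j mod k} = A" for j
      using card_congruent_below[of k A j] k(1) by (simp add: eq_commute)
  qed (use F in \<open>auto simp: d_def d0_def d1_def\<close>)
  then show ?thesis by (simp add: M_def s_def P_def Q_def)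
qed

lemma singular_turan_number_ge:
  fixes F :: "'b sgraph"
  assumes F: "simple_graph F" "card (vertices F) = p" "chromatic_number F = q" "3 \<le> p" "2 \<le> q"
  shows "\<exists>C n0. \<forall>n\<ge>n0.
    ((real n - real q)\<^sup>2 - real n * (real n / real ((p - 1) * (q - 1)) + C * sqrt (real n))) / 2
      \<le> real (singular_turan_number n F)"
proof -
  define s where "s = (p - 1) * (q - 1)"
  define C where "C = real (8 * q + 9 + 2 * p * p)"
  \<comment> \<open>Both constructions lose at most \<open>q\<close> vertices.\<close>
  have weaken: "((real n - real q)\<^sup>2 - real n * M) / 2 \<le> x"
    if "real N * (real N - M') / 2 \<le> x" "N \<le> n" "n \<le> N + q" "M' \<le> M" "0 \<le> M" "q \<le> n" for n N x M M'
  proof -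
    have "(real n - real q)\<^sup>2 \<le> (real N)\<^sup>2" using that by (intro power_mono) auto
    moreover have "real N * M' \<le> real N * M" using that by (intro mult_left_mono) auto
    moreover have "real N * M \<le> real n * M" using that by (intro mult_right_mono) auto
    ultimately show ?thesis using that(1) by (simp add: power2_eq_square algebra_simps)
  qed
  show ?thesis
  proof (cases "p = 3")
    case True
    have "((real n - real q)\<^sup>2 - real n * (real n / real s + C * sqrt (real n))) / 2
        \<le> real (singular_turan_number n F)" if n: "4 * q \<le> n" for n
    proof -
      obtain N where N: "N \<le> n" "n \<le> N + q"
        "real N * (real N - (real n / real (2 * (q - 1)) + 4)) / 2 \<le> real (singular_turan_number n F)"
        using singular_turan_number_ge_three[OF F(1) _ F(3,5) n] F(2) True by auto
      have "1 \<le> sqrt (real n)" using n F(5) by simp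
      then have "4 * 1 \<le> C * sqrt (real n)" by (intro mult_mono) (auto simp: C_def)
      then show ?thesis
        using True n F(5) by (intro weaken[OF N(3,1,2)]) (auto simp: s_def)
    qed
    then show ?thesis unfolding s_def by blast
  next
    case False
    define r0 where "r0 = (p - 1) * (q - 1) * (6 * (q - 1) + 1) + (p - 3) * (p - 3)"
    have "((real n - real q)\<^sup>2 - real n * (real n / real s + C * sqrt (real n))) / 2
        \<le> real (singular_turan_number n F)" if n: "q + (r0 + 1) * (r0 + 1) \<le> n" for n
    proof -
      define r where "r = floor_sqrt n"
      have r: "r * r \<le> n" "n < (r + 1) * (r + 1)"
        using floor_sqrt_power2_le[of n] Suc_floor_sqrt_power2_gt[of n]
        by (simp_all add: r_def power2_eq_square)
      have "r0 \<le> r"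
      proof (rule ccontr)
        assume "\<not> r0 \<le> r"
        then have "(r + 1) * (r + 1) \<le> (r0 + 1) * (r0 + 1)" by (intro mult_mono) auto
        then show False using r(2) n by linarith
      qed
      then have "real n * (real n - (real n / real s + C * real r)) / 2 \<le> real (singular_turan_number n F)"
        using singular_turan_number_ge_four[OF F(1-3) _ F(5) r] False F(4) unfolding r0_def s_def C_def by simp
      moreover have "real r \<le> sqrt (real n)"
        using r(1) by (intro real_le_rsqrt) (metis of_nat_le_iff of_nat_mult power2_eq_square)
      then have "C * real r \<le> C * sqrt (real n)" by (intro mult_left_mono) (auto simp: C_def)
      ultimately show ?thesis
        using n by (intro weaken[of n _ _ n]) (auto simp: C_def)
    qed
    then show ?thesis unfolding s_def by blast
  qed
qed

section \<open>Densities\<close>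

lemma singular_turan_number_le:
  fixes F :: "'b sgraph"
  assumes F: "simple_graph F" "card (vertices F) = p" "chromatic_number F = q" "3 \<le> p" "2 \<le> q"
    and eps: "0 < \<epsilon>"
  shows "\<exists>n0. \<forall>n\<ge>n0. real (singular_turan_number n F)
    \<le> ((1 - 1 / real ((p - 1) * (q - 1))) / 2 + \<epsilon>) * (real n)\<^sup>2"
proof -
  define s where "s = (p - 1) * (q - 1)"
  have "1 * 1 \<le> s" unfolding s_def using F(4,5) by (intro mult_le_mono) simp_all
  then have s: "1 \<le> s" by simp
  obtain c where c: "proper_colouring F c q" using chromatic_number_bounds(1)[OF F(1)] F by auto
  have ne: "edges F \<noteq> {}"
  proof
    assume "edges F = {}"
    then have "proper_colouring F (\<lambda>_. 0) 1" by (simp add: proper_colouring_def image_subset_iff)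
    then have "chromatic_number F \<le> 1" unfolding chromatic_number_def by (intro Least_le exI)
    then show False using F by simp
  qed
  from blowup_of_many_edges[OF eps s, of "p * p"]
  obtain n0 where n0: "\<forall>G :: nat sgraph. simple_graph G \<and> n0 \<le> card (vertices G) \<and>
      ((1 - 1 / real s) / 2 + \<epsilon>) * (real (card (vertices G)))\<^sup>2 \<le> real (card (edges G)) \<longrightarrow>
      (\<exists>X. has_blowup (\<lambda>u v. {u, v} \<in> edges G) (vertices G) (Suc s) (p * p) X)" by (rule exE)
  have "real (singular_turan_number n F) \<le> ((1 - 1 / real s) / 2 + \<epsilon>) * (real n)\<^sup>2" if n: "n0 \<le> n" for n
  proof (rule ccontr)
    assume big: "\<not> ?thesis"
    obtain G :: "nat sgraph" where G: "simple_graph G" "card (vertices G) = n"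
      "\<not> (\<exists>H. is_subgraph H G \<and> singular_in G H \<and> isomorphic_graphs F H)"
      "card (edges G) = singular_turan_number n F"
      using singular_turan_number_attained[OF ne] by metis
    obtain X where "has_blowup (\<lambda>u v. {u, v} \<in> edges G) (vertices G) (Suc s) (p * p) X"
      using n0[rule_format, of G] G n big by auto
    then show False
      using singular_copy_of_blowup[OF F(1) c _ F(2) _ G(1), of X] F G(3) by (auto simp: s_def)
  qed
  then show ?thesis unfolding s_def by blast
qed

text \<open>
  The complete \<open>s\<close>-partite graph whose parts are the residue classes modulo \<open>s\<close>.
\<close>

lemma turan_number_ge:
  assumes s: "1 \<le> s"
  shows "real n * (real n - real n / real s - 1) / 2 \<le> real (turan_number n (complete_graph (s + 1)))"
proof -
  define G where "G = graph_on {..<n} (\<lambda>i j. i mod s \<noteq> j mod s)"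
  have VG: "vertices G = {..<n}" by (simp add: G_def)
  have G: "simple_graph G" unfolding G_def by (rule simple_graph_on) auto
  have edge: "{i, j} \<in> edges G \<longleftrightarrow> i < n \<and> j < n \<and> i mod s \<noteq> j mod s" for i j
    unfolding G_def by (subst edge_graph_on_iff) auto
  have "\<not> (\<exists>H. is_subgraph H G \<and> isomorphic_graphs (complete_graph (s + 1)) H)"
  proof
    assume "\<exists>H. is_subgraph H G \<and> isomorphic_graphs (complete_graph (s + 1)) H"
    then obtain H where H: "is_subgraph H G" "isomorphic_graphs (complete_graph (s + 1)) H" by blast
    obtain f where f: "\<And>u v. {u, v} \<in> edges (complete_graph (s + 1)) \<Longrightarrow> {f u, f v} \<in> edges G"
      using subgraph_copyE[OF H] by metis
    have "inj_on (\<lambda>u. f u mod s) {..<s + 1}"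
    proof (rule inj_onI, rule ccontr)
      fix u v assume uv: "u \<in> {..<s + 1}" "v \<in> {..<s + 1}" "f u mod s = f v mod s" "u \<noteq> v"
      then have "{f u, f v} \<in> edges G" by (intro f) (simp add: complete_graph_edge_iff)
      then show False using uv(3) by (simp add: edge)
    qed
    moreover have "(\<lambda>u. f u mod s) ` {..<s + 1} \<subseteq> {..<s}" using s by auto
    ultimately have "card {..<s + 1} \<le> card {..<s}" by (rule card_inj_on_le) simp
    then show False by simp
  qed
  then have "card (edges G) \<le> turan_number n (complete_graph (s + 1))"
    using G by (intro card_edges_le_turan_number) (auto simp: VG)
  then have le: "real (card (edges G)) \<le> real (turan_number n (complete_graph (s + 1)))"
    by (simp only: of_nat_le_iff)
  have "real n * (real n - real n / real s - 1) \<le> 2 * real (card (edges G))"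
  proof -
    have "real n * (real n - real n / real s - 1) = (\<Sum>i<n. real n - real n / real s - 1)" by simp
    also have "\<dots> \<le> (\<Sum>i<n. real (vertex_degree G i))"
    proof (intro sum_mono)
      fix i assume "i \<in> {..<n}"
      then have "{j \<in> vertices G. {i, j} \<in> edges G} = {..<n} - {j \<in> {..<n}. j mod s = i mod s}"
        by (auto simp: edge VG)
      then have deg: "vertex_degree G i = n - card {j \<in> {..<n}. j mod s = i mod s}"
        unfolding vertex_degree_eq_card_neighbours[OF G]
        by (simp only:) (subst card_Diff_subset, auto)
      have "card {j \<in> {..<n}. j mod s = i mod s} \<le> card {..n div s}"
      proof (rule card_inj_on_le)
        show "inj_on (\<lambda>j. j div s) {j \<in> {..<n}. j mod s = i mod s}"
          by (rule inj_onI) (metis (mono_tags, lifting) div_mult_mod_eq mem_Collect_eq)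
      qed (auto intro: div_le_mono)
      then have "real (card {j \<in> {..<n}. j mod s = i mod s}) \<le> real (n div s) + 1" by simp
      also have "\<dots> \<le> real n / real s + 1" using of_nat_div_le_of_nat[of n s] by simp
      finally show "real n - real n / real s - 1 \<le> real (vertex_degree G i)"
        unfolding deg by linarith
    qed
    also have "\<dots> = real (2 * card (edges G))"
      by (simp only: handshake[OF G, symmetric] of_nat_sum VG)
    finally show ?thesis by simp
  qed
  then have "real n * (real n - real n / real s - 1) / 2 \<le> real (card (edges G))" by simp
  then show ?thesis using le by (rule order_trans)
qed

lemma turan_number_le:
  assumes s: "1 \<le> s" and eps: "0 < \<epsilon>"
  shows "\<exists>n0. \<forall>n\<ge>n0. real (turan_number n (complete_graph (s + 1)))
    \<le> ((1 - 1 / real s) / 2 + \<epsilon>) * (real n)\<^sup>2"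
proof -
  have "{0, 1} \<in> edges (complete_graph (s + 1))" using s by (simp add: complete_graph_edge_iff)
  then have ne: "edges (complete_graph (s + 1)) \<noteq> {}" by auto
  from blowup_of_many_edges[OF eps s, of 1]
  obtain n0 where n0: "\<forall>G :: nat sgraph. simple_graph G \<and> n0 \<le> card (vertices G) \<and>
      ((1 - 1 / real s) / 2 + \<epsilon>) * (real (card (vertices G)))\<^sup>2 \<le> real (card (edges G)) \<longrightarrow>
      (\<exists>X. has_blowup (\<lambda>u v. {u, v} \<in> edges G) (vertices G) (Suc s) 1 X)" by (rule exE)
  have "real (turan_number n (complete_graph (s + 1))) \<le> ((1 - 1 / real s) / 2 + \<epsilon>) * (real n)\<^sup>2"
    if n: "n0 \<le> n" for n
  proof (rule ccontr)
    assume big: "\<not> ?thesis"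
    obtain G :: "nat sgraph" where G: "simple_graph G" "card (vertices G) = n"
      "\<not> (\<exists>H. is_subgraph H G \<and> isomorphic_graphs (complete_graph (s + 1)) H)"
      "card (edges G) = turan_number n (complete_graph (s + 1))"
      using turan_number_attained[OF ne] by metis
    obtain X where X: "has_blowup (\<lambda>u v. {u, v} \<in> edges G) (vertices G) (Suc s) 1 X"
      using n0[rule_format, of G] G n big by auto
    define f where "f i = (SOME v. v \<in> X i)" for i
    have f: "f i \<in> X i" if "i < s + 1" for i
    proof -
      have "X i \<noteq> {}" using has_blowupD(2)[OF X, of i] that by auto
      then show ?thesis unfolding f_def by (simp add: some_in_eq)
    qed
    have V: "vertices (complete_graph (s + 1)) = {..<s + 1}" by (simp add: complete_graph_def)
    have edge: "{f i, f j} \<in> edges G" if "{i, j} \<in> edges (complete_graph (s + 1))" for i j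
      using that f has_blowupD(3)[OF X, of i j] by (auto simp: complete_graph_edge_iff)
    have inj: "inj_on f (vertices (complete_graph (s + 1)))"
      unfolding V
    proof (rule inj_onI, rule ccontr)
      fix i j assume ij: "i \<in> {..<s + 1}" "j \<in> {..<s + 1}" "f i = f j" "i \<noteq> j"
      then have "{f i, f j} \<in> edges G" by (intro edge) (simp add: complete_graph_edge_iff)
      then show False using simple_graph_edgeD(3)[OF G(1)] ij(3) by blast
    qed
    have sub: "f ` vertices (complete_graph (s + 1)) \<subseteq> vertices G"
      unfolding V using f has_blowupD(1)[OF X] by fastforce
    show False
      using subgraph_copyI[OF simple_complete_graph inj sub edge] G(3) by blast
  qed
  then show ?thesis by blast
qed

text \<open>
  The lower bounds for extremal numbers are explicit functions, the upper bounds come with an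
  arbitrary \<open>\<epsilon>\<close>; this combines the two.
\<close>

lemma quadratic_limit:
  fixes u :: "nat \<Rightarrow> nat"
  assumes lower: "\<forall>n\<ge>n0. l n \<le> real (u n)" "(\<lambda>n. l n / (real n)\<^sup>2) \<longlonglongrightarrow> c"
    and upper: "\<And>\<epsilon>. 0 < \<epsilon> \<Longrightarrow> \<exists>n1. \<forall>n\<ge>n1. real (u n) \<le> (c + \<epsilon>) * (real n)\<^sup>2"
  shows "(\<lambda>n. real (u n) / (real n)\<^sup>2) \<longlonglongrightarrow> c"
proof (rule order_tendstoI)
  fix a assume "a < c"
  then have "\<forall>\<^sub>F n in sequentially. a < l n / (real n)\<^sup>2" using lower(2) by (rule order_tendstoD(1)[rotated])
  then show "\<forall>\<^sub>F n in sequentially. a < real (u n) / (real n)\<^sup>2"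
    using eventually_ge_at_top[of n0]
  proof eventually_elim
    case (elim n)
    then have "l n / (real n)\<^sup>2 \<le> real (u n) / (real n)\<^sup>2" using lower(1) by (intro divide_right_mono) auto
    then show ?case using elim by linarith
  qed
next
  fix a assume a: "c < a"
  then obtain n1 where n1: "\<forall>n\<ge>n1. real (u n) \<le> (c + (a - c) / 2) * (real n)\<^sup>2"
    using upper[of "(a - c) / 2"] by auto
  show "\<forall>\<^sub>F n in sequentially. real (u n) / (real n)\<^sup>2 < a"
    using eventually_ge_at_top[of n1] eventually_gt_at_top[of 0]
  proof eventually_elim
    case (elim n)
    then have "real (u n) / (real n)\<^sup>2 \<le> c + (a - c) / 2" using n1 by (simp add: pos_divide_le_eq)
    moreover have "c + (a - c) / 2 < a" using a by (simp add: field_simps)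
    ultimately show ?case by linarith
  qed
qed

lemma singular_turan_density:
  fixes F :: "'b sgraph"
  assumes F: "simple_graph F" "card (vertices F) = p" "chromatic_number F = q" "3 \<le> p" "2 \<le> q"
  shows "(\<lambda>n. real (singular_turan_number n F) / (real n)\<^sup>2)
    \<longlonglongrightarrow> (1 - 1 / real ((p - 1) * (q - 1))) / 2"
proof -
  obtain C n0 where lower: "\<forall>n\<ge>n0.
    ((real n - real q)\<^sup>2 - real n * (real n / real ((p - 1) * (q - 1)) + C * sqrt (real n))) / 2
      \<le> real (singular_turan_number n F)" using singular_turan_number_ge[OF F] by auto
  have lim: "(\<lambda>n. (((real n - a)\<^sup>2 - real n * (real n / s + C * sqrt (real n))) / 2) / (real n)\<^sup>2)
    \<longlonglongrightarrow> (1 - 1 / s) / 2" for a s :: real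
  proof -
    have "(\<lambda>n. a / real n) \<longlonglongrightarrow> 0" "(\<lambda>n. C / sqrt (real n)) \<longlonglongrightarrow> 0" by real_asymp+
    then have "(\<lambda>n. ((1 - a / real n)\<^sup>2 - (1 / s + C / sqrt (real n))) / 2)
        \<longlonglongrightarrow> ((1 - 0)\<^sup>2 - (1 / s + 0)) / 2"
      by (intro tendsto_divide tendsto_diff tendsto_add tendsto_power tendsto_const) simp_all
    moreover have "\<forall>\<^sub>F n in sequentially. ((1 - a / real n)\<^sup>2 - (1 / s + C / sqrt (real n))) / 2
       = (((real n - a)\<^sup>2 - real n * (real n / s + C * sqrt (real n))) / 2) / (real n)\<^sup>2"
      using eventually_gt_at_top[of 0]
    proof eventually_elim
      case (elim n)
      have "(1 - a / real n)\<^sup>2 = (real n - a)\<^sup>2 / (real n)\<^sup>2"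
        using elim by (simp add: power_divide[symmetric] diff_divide_distrib)
      moreover have "1 / s = real n * (real n / s) / (real n)\<^sup>2" using elim by (simp add: power2_eq_square)
      moreover have "C / sqrt (real n) = real n * (C * sqrt (real n)) / (real n)\<^sup>2"
        using elim by (simp add: power2_eq_square field_simps)
      ultimately show ?case by (simp add: diff_divide_distrib add_divide_distrib distrib_left)
    qed
    ultimately have "(\<lambda>n. (((real n - a)\<^sup>2 - real n * (real n / s + C * sqrt (real n))) / 2) / (real n)\<^sup>2)
        \<longlonglongrightarrow> ((1 - 0)\<^sup>2 - (1 / s + 0)) / 2" by (rule Lim_transform_eventually)
    then show ?thesis by simp
  qed
  show ?thesis
    by (rule quadratic_limit[OF lower lim singular_turan_number_le[OF F]])
qed

lemma turan_density:
  assumes s: "1 \<le> s"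
  shows "(\<lambda>n. real (turan_number n (complete_graph (s + 1))) / (real n)\<^sup>2)
    \<longlonglongrightarrow> (1 - 1 / real s) / 2"
proof (rule quadratic_limit[OF _ _ turan_number_le[OF s]])
  show "\<forall>n\<ge>0. real n * (real n - real n / real s - 1) / 2 \<le> real (turan_number n (complete_graph (s + 1)))"
    using turan_number_ge[OF s] by blast
  have "(\<lambda>n. 1 / real n) \<longlonglongrightarrow> 0" by real_asymp
  then have "(\<lambda>n. (1 - 1 / real s - 1 / real n) / 2) \<longlonglongrightarrow> (1 - 1 / real s - 0) / 2"
    by (intro tendsto_divide tendsto_diff tendsto_const) simp_all
  moreover have "\<forall>\<^sub>F n in sequentially. (1 - 1 / real s - 1 / real n) / 2
      = (real n * (real n - real n / real s - 1) / 2) / (real n)\<^sup>2"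
    using eventually_gt_at_top[of 0]
    by eventually_elim (simp add: field_simps power2_eq_square)
  ultimately have "(\<lambda>n. (real n * (real n - real n / real s - 1) / 2) / (real n)\<^sup>2)
      \<longlonglongrightarrow> (1 - 1 / real s - 0) / 2" by (rule Lim_transform_eventually)
  then show "(\<lambda>n. (real n * (real n - real n / real s - 1) / 2) / (real n)\<^sup>2)
      \<longlonglongrightarrow> (1 - 1 / real s) / 2" by simp
qed

lemma singular_turan_number_complete_le:
  assumes p: "2 \<le> p"
  shows "singular_turan_number n (complete_graph p) \<le> turan_number n (complete_graph ((p - 1)\<^sup>2 + 1))"
proof -
  let ?K = "complete_graph ((p - 1)\<^sup>2 + 1)"
  have "{0, 1} \<in> edges (complete_graph p)" using p by (simp add: complete_graph_edge_iff)
  then have "edges (complete_graph p) \<noteq> {}" by auto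
  then obtain G :: "nat sgraph" where G: "simple_graph G" "card (vertices G) = n"
    "\<not> (\<exists>H. is_subgraph H G \<and> singular_in G H \<and> isomorphic_graphs (complete_graph p) H)"
    "card (edges G) = singular_turan_number n (complete_graph p)"
    using singular_turan_number_attained by metis
  have V: "vertices ?K = {..<(p - 1)\<^sup>2 + 1}" by (simp add: complete_graph_def)
  have "\<not> (\<exists>H. is_subgraph H G \<and> isomorphic_graphs ?K H)"
  proof
    assume "\<exists>H. is_subgraph H G \<and> isomorphic_graphs ?K H"
    then obtain H where H: "is_subgraph H G" "isomorphic_graphs ?K H" by blast
    obtain f where f: "inj_on f (vertices ?K)" "f ` vertices ?K = vertices H" "vertices H \<subseteq> vertices G"
      and edge: "\<And>u v. {u, v} \<in> edges ?K \<Longrightarrow> {f u, f v} \<in> edges G"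
      using subgraph_copyE[OF H] by metis
    have "card (vertices ?K) = Suc ((p - 1) * (p - 1))" unfolding V by (simp add: power2_eq_square)
    then have "card (vertices H) = Suc ((p - 1) * (p - 1))" using card_image[OF f(1)] f(2) by simp
    moreover have "{u, v} \<in> edges G" if uv: "u \<in> vertices H" "v \<in> vertices H" "u \<noteq> v" for u v
    proof -
      obtain i j where "i \<in> vertices ?K" "u = f i" "j \<in> vertices ?K" "v = f j"
        using uv f(2) by blast
      then have "{i, j} \<in> edges ?K"
        unfolding complete_graph_edge_iff V using uv(3) by auto
      then show ?thesis using edge \<open>u = f i\<close> \<open>v = f j\<close> by simp
    qed
    ultimately show False
      using singular_clique_of_clique[OF G(1) f(3), of p] p G(3) by auto
  qed
  then show ?thesis using card_edges_le_turan_number[OF G(1,2)] G(4) by metis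
qed

lemma ratio_of_quadratic_limits:
  fixes u v :: "nat \<Rightarrow> real"
  assumes "(\<lambda>n. u n / (real n)\<^sup>2) \<longlonglongrightarrow> c" "(\<lambda>n. v n / (real n)\<^sup>2) \<longlonglongrightarrow> c"
  shows "(\<lambda>n. u n - v n) \<in> o(\<lambda>n. (real n)\<^sup>2)" and "c \<noteq> 0 \<Longrightarrow> u \<sim>[at_top] v"
proof -
  have nz: "\<forall>\<^sub>F n in sequentially. (real n)\<^sup>2 \<noteq> 0"
    using eventually_gt_at_top[of 0] by eventually_elim simp
  have "(\<lambda>n. (u n - v n) / (real n)\<^sup>2) \<longlonglongrightarrow> 0"
    using tendsto_diff[OF assms] by (simp add: diff_divide_distrib)
  then show "(\<lambda>n. u n - v n) \<in> o(\<lambda>n. (real n)\<^sup>2)"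
    using nz by (intro smalloI_tendsto) auto
  show "u \<sim>[at_top] v" if c: "c \<noteq> 0"
  proof (rule asymp_equivI')
    have "(\<lambda>n. (u n / (real n)\<^sup>2) / (v n / (real n)\<^sup>2)) \<longlonglongrightarrow> c / c"
      by (rule tendsto_divide[OF assms c])
    moreover have "\<forall>\<^sub>F n in sequentially. (u n / (real n)\<^sup>2) / (v n / (real n)\<^sup>2) = u n / v n"
      using nz by eventually_elim simp
    ultimately have "(\<lambda>n. u n / v n) \<longlonglongrightarrow> c / c" by (rule Lim_transform_eventually)
    then show "(\<lambda>n. u n / v n) \<longlonglongrightarrow> 1" using c by simp
  qed
qed

theorem theorem40:
  fixes p :: nat
  assumes "p \<ge> 3"
  shows "(\<forall>(F :: 'a sgraph) q :: nat.
            simple_graph F \<and> card (vertices F) = p \<and> chromatic_number F = q \<and> q \<ge> 2 \<longrightarrow>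
              (\<exists>g :: nat \<Rightarrow> real. g \<in> o(\<lambda>n. (real n)\<^sup>2) \<and>
                 (\<forall>n. real (singular_turan_number n F)
                        \<le> real (turan_number n (complete_graph ((p - 1) * (q - 1) + 1))) + g n)) \<and>
              (\<lambda>n. real (singular_turan_number n F))
                \<sim>[at_top] (\<lambda>n. real (turan_number n (complete_graph ((p - 1) * (q - 1) + 1)))))
       \<and> (\<forall>n. singular_turan_number n (complete_graph p)
                \<le> turan_number n (complete_graph ((p - 1)\<^sup>2 + 1)))
       \<and> (\<lambda>n. real (singular_turan_number n (complete_graph p)))
            \<sim>[at_top] (\<lambda>n. real (turan_number n (complete_graph ((p - 1)\<^sup>2 + 1))))"
proof -
  have density: "(\<lambda>n. real (turan_number n (complete_graph ((p - 1) * (q - 1) + 1))) / (real n)\<^sup>2)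
      \<longlonglongrightarrow> (1 - 1 / real ((p - 1) * (q - 1))) / 2"
    and pos: "(1 - 1 / real ((p - 1) * (q - 1))) / 2 \<noteq> 0" if "2 \<le> q" for q
  proof -
    have "2 * 1 \<le> (p - 1) * (q - 1)" using assms that by (intro mult_le_mono) auto
    then have s: "2 \<le> (p - 1) * (q - 1)" by simp
    then show "(\<lambda>n. real (turan_number n (complete_graph ((p - 1) * (q - 1) + 1))) / (real n)\<^sup>2)
        \<longlonglongrightarrow> (1 - 1 / real ((p - 1) * (q - 1))) / 2"
      by (intro turan_density) linarith
    have "real ((p - 1) * (q - 1)) \<noteq> 1" using s by linarith
    then show "(1 - 1 / real ((p - 1) * (q - 1))) / 2 \<noteq> 0" by auto
  qed
  have general: "(\<lambda>n. real (singular_turan_number n F)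
          - real (turan_number n (complete_graph ((p - 1) * (q - 1) + 1)))) \<in> o(\<lambda>n. (real n)\<^sup>2)"
      "(\<lambda>n. real (singular_turan_number n F))
         \<sim>[at_top] (\<lambda>n. real (turan_number n (complete_graph ((p - 1) * (q - 1) + 1))))"
    if F: "simple_graph F" "card (vertices F) = p" "chromatic_number F = q" "2 \<le> q"
    for F :: "'c sgraph" and q
    using ratio_of_quadratic_limits[OF singular_turan_density[OF F(1-3) assms F(4)] density[OF F(4)]]
      pos[OF F(4)] by blast+
  show ?thesis
  proof (intro conjI allI impI)
    fix F :: "'a sgraph" and q :: nat
    assume "simple_graph F \<and> card (vertices F) = p \<and> chromatic_number F = q \<and> q \<ge> 2"
    then have F: "simple_graph F" "card (vertices F) = p" "chromatic_number F = q" "2 \<le> q" by auto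
    show "\<exists>g :: nat \<Rightarrow> real. g \<in> o(\<lambda>n. (real n)\<^sup>2) \<and>
        (\<forall>n. real (singular_turan_number n F)
          \<le> real (turan_number n (complete_graph ((p - 1) * (q - 1) + 1))) + g n)"
      by (rule exI, rule conjI, rule general(1)[OF F]) simp
    show "(\<lambda>n. real (singular_turan_number n F))
        \<sim>[at_top] (\<lambda>n. real (turan_number n (complete_graph ((p - 1) * (q - 1) + 1))))"
      by (rule general(2)[OF F])
  next
    show "singular_turan_number n (complete_graph p) \<le> turan_number n (complete_graph ((p - 1)\<^sup>2 + 1))" for n
      using assms by (intro singular_turan_number_complete_le) simp
    have "chromatic_number (complete_graph p) = p"
      using assms by (simp add: chromatic_number_complete_graph)
    moreover have "card (vertices (complete_graph p)) = p" by (simp add: complete_graph_def)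
    ultimately show "(\<lambda>n. real (singular_turan_number n (complete_graph p)))
        \<sim>[at_top] (\<lambda>n. real (turan_number n (complete_graph ((p - 1)\<^sup>2 + 1))))"
      using general(2)[of "complete_graph p" p, OF simple_complete_graph] assms
      by (simp add: power2_eq_square)
  qed
qed

end
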